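(* Let $K$ be an infinite weakly small field. Then every algebraic field extension $L$ of $K$ is Artin-Schreier closed.
   Context: Fields may carry extra first-order structure beyond the field language. A first-order structure $M$ is weakly small if for every finite subset $A$ of $M$ there are only countably many complete $1$-types over $A$. A field extension $L'/L$ in characteristic $p>0$ is an Artin-Schreier extension if $L'$ is generated over $L$ by an element $x$ with $x^p-x\in L$. A field $L$ of characteristic $p>0$ is Artin-Schreier closed if it has no proper Artin-Schreier extension, i.e. the map $x\mapsto x^p-x$ from $L$ to $L$ is surjective. (In characteristic zero there are no Artin-Schreier extensions and the condition is vacuous.) *)

theory Defs
  imports "HOL-Algebra.Algebra" "HOL-Library.Countable_Set"
begin

section \<open>First-order logic\<close>

record ('f, 'r) language =
  funs :: "'f set"
  rels :: "'r set"
  fun_arity :: "'f \<Rightarrow> nat"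
  rel_arity :: "'r \<Rightarrow> nat"

record ('f, 'r, 'a) fo_struct =
  dom :: "'a set"
  fun_int :: "'f \<Rightarrow> 'a list \<Rightarrow> 'a"
  rel_int :: "'r \<Rightarrow> 'a list \<Rightarrow> bool"

definition fo_structure :: "('f, 'r) language \<Rightarrow> ('f, 'r, 'a) fo_struct \<Rightarrow> bool" where
  "fo_structure \<L> M \<longleftrightarrow>
     dom M \<noteq> {} \<and>
     (\<forall>f \<in> funs \<L>. \<forall>xs. set xs \<subseteq> dom M \<and> length xs = fun_arity \<L> f \<longrightarrow> fun_int M f xs \<in> dom M)"

text \<open>
  Constants are function symbols of arity 0. The constructor \<open>Par\<close> names an element of the
  structure, so that terms and formulas built with parameters from \<open>A\<close> are those of the
  language expanded by a constant for each element of \<open>A\<close>.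
\<close>

datatype ('f, 'a) tm = Var nat | Par 'a | Fn 'f "('f, 'a) tm list"

datatype ('f, 'r, 'a) fm =
    Eq "('f, 'a) tm" "('f, 'a) tm"
  | Rel 'r "('f, 'a) tm list"
  | Neg "('f, 'r, 'a) fm"
  | Conj "('f, 'r, 'a) fm" "('f, 'r, 'a) fm"
  | Exi nat "('f, 'r, 'a) fm"

fun wf_tm :: "('f, 'r) language \<Rightarrow> 'a set \<Rightarrow> ('f, 'a) tm \<Rightarrow> bool" where
  "wf_tm \<L> A (Var n) \<longleftrightarrow> True"
| "wf_tm \<L> A (Par a) \<longleftrightarrow> a \<in> A"
| "wf_tm \<L> A (Fn f ts) \<longleftrightarrow>
     f \<in> funs \<L> \<and> length ts = fun_arity \<L> f \<and> (\<forall>t \<in> set ts. wf_tm \<L> A t)"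

fun wf_fm :: "('f, 'r) language \<Rightarrow> 'a set \<Rightarrow> ('f, 'r, 'a) fm \<Rightarrow> bool" where
  "wf_fm \<L> A (Eq s t) \<longleftrightarrow> wf_tm \<L> A s \<and> wf_tm \<L> A t"
| "wf_fm \<L> A (Rel r ts) \<longleftrightarrow>
     r \<in> rels \<L> \<and> length ts = rel_arity \<L> r \<and> (\<forall>t \<in> set ts. wf_tm \<L> A t)"
| "wf_fm \<L> A (Neg \<phi>) \<longleftrightarrow> wf_fm \<L> A \<phi>"
| "wf_fm \<L> A (Conj \<phi> \<psi>) \<longleftrightarrow> wf_fm \<L> A \<phi> \<and> wf_fm \<L> A \<psi>"
| "wf_fm \<L> A (Exi n \<phi>) \<longleftrightarrow> wf_fm \<L> A \<phi>"

fun fv_tm :: "('f, 'a) tm \<Rightarrow> nat set" where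
  "fv_tm (Var n) = {n}"
| "fv_tm (Par a) = {}"
| "fv_tm (Fn f ts) = (\<Union>t \<in> set ts. fv_tm t)"

fun fv_fm :: "('f, 'r, 'a) fm \<Rightarrow> nat set" where
  "fv_fm (Eq s t) = fv_tm s \<union> fv_tm t"
| "fv_fm (Rel r ts) = (\<Union>t \<in> set ts. fv_tm t)"
| "fv_fm (Neg \<phi>) = fv_fm \<phi>"
| "fv_fm (Conj \<phi> \<psi>) = fv_fm \<phi> \<union> fv_fm \<psi>"
| "fv_fm (Exi n \<phi>) = fv_fm \<phi> - {n}"

fun eval_tm :: "('f, 'r, 'a) fo_struct \<Rightarrow> (nat \<Rightarrow> 'a) \<Rightarrow> ('f, 'a) tm \<Rightarrow> 'a" where
  "eval_tm M e (Var n) = e n"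
| "eval_tm M e (Par a) = a"
| "eval_tm M e (Fn f ts) = fun_int M f (map (eval_tm M e) ts)"

fun sat :: "('f, 'r, 'a) fo_struct \<Rightarrow> (nat \<Rightarrow> 'a) \<Rightarrow> ('f, 'r, 'a) fm \<Rightarrow> bool" where
  "sat M e (Eq s t) \<longleftrightarrow> eval_tm M e s = eval_tm M e t"
| "sat M e (Rel r ts) \<longleftrightarrow> rel_int M r (map (eval_tm M e) ts)"
| "sat M e (Neg \<phi>) \<longleftrightarrow> \<not> sat M e \<phi>"
| "sat M e (Conj \<phi> \<psi>) \<longleftrightarrow> sat M e \<phi> \<and> sat M e \<psi>"
| "sat M e (Exi n \<phi>) \<longleftrightarrow> (\<exists>a \<in> dom M. sat M (e(n := a)) \<phi>)"

section \<open>Types and weak smallness\<close>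

definition formulas1 :: "('f, 'r) language \<Rightarrow> 'a set \<Rightarrow> ('f, 'r, 'a) fm set" where
  "formulas1 \<L> A = {\<phi>. wf_fm \<L> A \<phi> \<and> fv_fm \<phi> \<subseteq> {0}}"

text \<open>Only the value of variable 0 matters for the formulas considered here.\<close>

definition finitely_satisfiable1 :: "('f, 'r, 'a) fo_struct \<Rightarrow> ('f, 'r, 'a) fm set \<Rightarrow> bool" where
  "finitely_satisfiable1 M p \<longleftrightarrow>
     (\<forall>F. finite F \<and> F \<subseteq> p \<longrightarrow> (\<exists>a \<in> dom M. \<forall>\<phi> \<in> F. sat M (\<lambda>_. a) \<phi>))"

text \<open>
  A complete 1-type over \<open>A\<close> is a maximal set of formulas in one free variable with parameters
  in \<open>A\<close> that is finitely satisfiable in \<open>M\<close>. It need not be realised in \<open>M\<close> itself.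
\<close>

definition complete_types1 ::
    "('f, 'r) language \<Rightarrow> ('f, 'r, 'a) fo_struct \<Rightarrow> 'a set \<Rightarrow> ('f, 'r, 'a) fm set set" where
  "complete_types1 \<L> M A =
     {p. p \<subseteq> formulas1 \<L> A \<and> finitely_satisfiable1 M p \<and>
         (\<forall>q. q \<subseteq> formulas1 \<L> A \<and> finitely_satisfiable1 M q \<and> p \<subseteq> q \<longrightarrow> q = p)}"

definition weakly_small :: "('f, 'r) language \<Rightarrow> ('f, 'r, 'a) fo_struct \<Rightarrow> bool" where
  "weakly_small \<L> M \<longleftrightarrow>
     (\<forall>A. finite A \<and> A \<subseteq> dom M \<longrightarrow> countable (complete_types1 \<L> M A))"

section \<open>Fields with extra structure\<close>

datatype 'f field_sym = ZeroS | OneS | AddS | MinusS | MultS | Extra 'f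

text \<open>
  The language contains the field language, and may contain further function symbols
  \<open>Extra f\<close> and arbitrary relation symbols, on whose interpretation there is no constraint.
\<close>

definition expands_field ::
    "('f field_sym, 'r) language \<Rightarrow> ('f field_sym, 'r, 'a) fo_struct \<Rightarrow> 'a ring \<Rightarrow> bool" where
  "expands_field \<L> M K \<longleftrightarrow>
     fo_structure \<L> M \<and> dom M = carrier K \<and>
     {ZeroS, OneS, AddS, MinusS, MultS} \<subseteq> funs \<L> \<and>
     fun_arity \<L> ZeroS = 0 \<and> fun_arity \<L> OneS = 0 \<and> fun_arity \<L> AddS = 2 \<and>
     fun_arity \<L> MinusS = 1 \<and> fun_arity \<L> MultS = 2 \<and>
     fun_int M ZeroS [] = \<zero>\<^bsub>K\<^esub> \<and> fun_int M OneS [] = \<one>\<^bsub>K\<^esub> \<and>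
     (\<forall>x \<in> carrier K. fun_int M MinusS [x] = \<ominus>\<^bsub>K\<^esub> x) \<and>
     (\<forall>x \<in> carrier K. \<forall>y \<in> carrier K.
        fun_int M AddS [x, y] = x \<oplus>\<^bsub>K\<^esub> y \<and> fun_int M MultS [x, y] = x \<otimes>\<^bsub>K\<^esub> y)"

section \<open>Field extensions\<close>

text \<open>
  A field extension is given with its embedding \<open>h\<close>, which is injective because a unital ring
  homomorphism between fields is.
\<close>

definition field_extension :: "'a ring \<Rightarrow> 'b ring \<Rightarrow> ('a \<Rightarrow> 'b) \<Rightarrow> bool" where
  "field_extension K L h \<longleftrightarrow> field K \<and> field L \<and> h \<in> ring_hom K L"

definition algebraic_field_extension :: "'a ring \<Rightarrow> 'b ring \<Rightarrow> ('a \<Rightarrow> 'b) \<Rightarrow> bool" where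
  "algebraic_field_extension K L h \<longleftrightarrow>
     field_extension K L h \<and>
     (\<forall>x \<in> carrier L. ((ring.algebraic L) over (h ` carrier K)) x)"

definition characteristic :: "'a ring \<Rightarrow> nat" where
  "characteristic R =
     (if \<exists>n::nat. 0 < n \<and> [n] \<cdot>\<^bsub>R\<^esub> \<one>\<^bsub>R\<^esub> = \<zero>\<^bsub>R\<^esub>
      then LEAST n::nat. 0 < n \<and> [n] \<cdot>\<^bsub>R\<^esub> \<one>\<^bsub>R\<^esub> = \<zero>\<^bsub>R\<^esub>
      else 0)"

definition artin_schreier_map :: "'a ring \<Rightarrow> 'a \<Rightarrow> 'a" where
  "artin_schreier_map L x = x [^]\<^bsub>L\<^esub> characteristic L \<ominus>\<^bsub>L\<^esub> x"

definition artin_schreier_extension :: "'a ring \<Rightarrow> 'b ring \<Rightarrow> ('a \<Rightarrow> 'b) \<Rightarrow> bool" where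
  "artin_schreier_extension L L' j \<longleftrightarrow>
     field_extension L L' j \<and> characteristic L > 0 \<and>
     (\<exists>x \<in> carrier L'. artin_schreier_map L' x \<in> j ` carrier L \<and>
        carrier L' = generate_field L' (insert x (j ` carrier L)))"

text \<open>
  Surjectivity of the map on \<open>L\<close> is used here because the absence of proper Artin-Schreier
  extensions quantifies over fields of arbitrary type; a theorem can assert the latter
  separately, for a type variable.
\<close>

definition artin_schreier_closed :: "'a ring \<Rightarrow> bool" where
  "artin_schreier_closed L \<longleftrightarrow>
     (characteristic L > 0 \<longrightarrow> artin_schreier_map L ` carrier L = carrier L)"

end

theory Submission
  imports Defs
begin

text \<open>
  The heart of the matter is that an additive endomorphism \<open>f\<close> of an infinite weakly small
  field \<open>K\<close> is surjective as soon as it is given by a term with parameters and has a finite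
  kernel (\<open>additive_endomorphism_surjective\<close>).

  Weak smallness forbids a binary tree of nonempty sets definable over a finite set \<open>A\<close>,
  because its branches would give uncountably many 1-types over \<open>A\<close>. This implies a descending
  chain condition: if \<open>R\<close> is the algebraic closure of \<open>A\<close> in the structure, then the
  traces on \<open>R\<close> of a descending sequence of \<open>A\<close>-definable additive subgroups become
  stationary (\<open>no_descending_chain_of_traces\<close>). Enlarge \<open>A\<close> such that \<open>R\<close> is
  infinite and contains a given target \<open>c \<noteq> 0\<close>. The chain condition for the images of the
  iterates of \<open>f\<close> shows that the trace of \<open>f(K)\<close> has finite index in \<open>R\<close>
  (\<open>finite_defect\<close>). Hence any finitely many of the groups \<open>b f(K)\<close>, with \<open>b\<close> a
  nonzero element of \<open>R\<close>, have a common nonzero element in \<open>R\<close>. By the chain condition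
  for intersections of these groups all of them together have one, say \<open>r\<close>. For
  \<open>b = r / c\<close> this says that \<open>c\<close> is a value of \<open>f\<close>.

  Finite extensions of \<open>K\<close> are not directly accessible, since their elements correspond to
  tuples from \<open>K\<close> and weak smallness speaks about 1-types only. However, let \<open>\<phi>\<close> be
  the Frobenius map in characteristic \<open>p\<close>. For \<open>v\<close> algebraic over \<open>K\<close> the
  elements \<open>v, \<phi> v, \<phi>\<^sup>2 v, \<dots>\<close> satisfy a
  linear relation over \<open>K\<close>. With it the equation \<open>w\<^sup>p - w = v\<close> becomes a system
  for the coefficients of \<open>w\<close> which reduces to one equation \<open>f(z) = 1\<close> in \<open>K\<close>,
  where \<open>f\<close> is an additive polynomial with linear coefficient \<open>-1\<close>. So \<open>f\<close>
  has a finite kernel, and the surjectivity of \<open>f\<close> applies. The absence of proper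
  Artin-Schreier extensions follows because two solutions of the same equation differ by an element
  of the prime field.
\<close>

section \<open>Definable sets and weak smallness\<close>

lemma eval_tm_cong:
  assumes "\<And>n. n \<in> fv_tm t \<Longrightarrow> e n = e' n"
  shows "eval_tm M e t = eval_tm M e' t"
  using assms
proof (induction t)
  case (Fn f ts)
  then have "map (eval_tm M e) ts = map (eval_tm M e') ts" by (simp, blast)
  then show ?case by (simp only: eval_tm.simps)
qed simp_all

lemma sat_cong:
  assumes "\<And>n. n \<in> fv_fm \<phi> \<Longrightarrow> e n = e' n"
  shows "sat M e \<phi> \<longleftrightarrow> sat M e' \<phi>"
  using assms
proof (induction \<phi> arbitrary: e e')
  case (Eq s t)
  then show ?case using eval_tm_cong[of s e e' M] eval_tm_cong[of t e e' M] by auto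
next
  case (Rel r ts)
  then have "map (eval_tm M e) ts = map (eval_tm M e') ts"
    by (auto intro!: eval_tm_cong)
  then show ?case by (simp only: sat.simps)
next
  case (Neg \<phi>)
  have "sat M e \<phi> \<longleftrightarrow> sat M e' \<phi>" using Neg.prems by (intro Neg.IH) simp
  then show ?case by simp
next
  case (Conj \<phi> \<psi>)
  have "sat M e \<phi> \<longleftrightarrow> sat M e' \<phi>" using Conj.prems by (intro Conj.IH(1)) simp
  moreover have "sat M e \<psi> \<longleftrightarrow> sat M e' \<psi>" using Conj.prems by (intro Conj.IH(2)) simp
  ultimately show ?case by simp
next
  case (Exi n \<phi>)
  have "sat M (e(n := a)) \<phi> \<longleftrightarrow> sat M (e'(n := a)) \<phi>" for a
    using Exi.prems by (intro Exi.IH) simp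
  then show ?case by simp
qed

definition definable ::
    "('f, 'r) language \<Rightarrow> ('f, 'r, 'a) fo_struct \<Rightarrow> 'a set \<Rightarrow> 'a set \<Rightarrow> bool" where
  "definable \<L> M A D \<longleftrightarrow> (\<exists>\<phi> \<in> formulas1 \<L> A. D = {a \<in> dom M. sat M (\<lambda>_. a) \<phi>})"

lemma definable_subset: "definable \<L> M A D \<Longrightarrow> D \<subseteq> dom M"
  unfolding definable_def by blast

text \<open>
  Finite satisfiability passes to unions of chains, so Zorn's lemma applies.
\<close>

lemma finitely_satisfiable1_extends:
  assumes "p \<subseteq> formulas1 \<L> A" and "finitely_satisfiable1 M p"
  shows "\<exists>q \<in> complete_types1 \<L> M A. p \<subseteq> q"
proof -
  define S where "S = {q. q \<subseteq> formulas1 \<L> A \<and> finitely_satisfiable1 M q \<and> p \<subseteq> q}"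
  have "\<exists>m \<in> S. \<forall>q \<in> S. m \<subseteq> q \<longrightarrow> q = m"
  proof (rule subset_Zorn_nonempty)
    have "p \<in> S" unfolding S_def using assms by simp
    then show "S \<noteq> {}" by blast
  next
    fix C assume C: "C \<noteq> {}" "subset.chain S C"
    have "finitely_satisfiable1 M (\<Union>C)"
      unfolding finitely_satisfiable1_def
    proof (intro allI impI, elim conjE)
      fix F assume F: "finite F" "F \<subseteq> \<Union>C"
      obtain q where q: "q \<in> C" "F \<subseteq> q"
        using finite_subset_Union_chain[OF F C] by blast
      then have "finitely_satisfiable1 M q"
        using C(2) unfolding subset.chain_def S_def by auto
      then show "\<exists>a \<in> dom M. \<forall>\<phi> \<in> F. sat M (\<lambda>_. a) \<phi>"
        using F(1) q(2) unfolding finitely_satisfiable1_def by simp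
    qed
    then show "\<Union>C \<in> S"
      using C unfolding S_def subset.chain_def by blast
  qed
  then obtain m where m: "m \<in> S" "\<And>q. q \<in> S \<Longrightarrow> m \<subseteq> q \<Longrightarrow> q = m" by blast
  have "q = m" if "q \<subseteq> formulas1 \<L> A" "finitely_satisfiable1 M q" "m \<subseteq> q" for q
    using that m unfolding S_def by blast
  with m(1) have "m \<in> complete_types1 \<L> M A" "p \<subseteq> m"
    unfolding S_def complete_types1_def by simp_all
  then show ?thesis by blast
qed

lemma nested_definable_sets_in_type:
  assumes def: "\<And>n. definable \<L> M A (E n)" and ne: "\<And>n. E n \<noteq> {}"
    and dec: "\<And>n. E (Suc n) \<subseteq> E n"
  shows "\<exists>q \<in> complete_types1 \<L> M A. \<forall>n. \<exists>\<phi> \<in> q. E n = {a \<in> dom M. sat M (\<lambda>_. a) \<phi>}"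
proof -
  have "\<forall>n. \<exists>\<phi>. \<phi> \<in> formulas1 \<L> A \<and> E n = {a \<in> dom M. sat M (\<lambda>_. a) \<phi>}"
    using def unfolding definable_def Bex_def by simp
  from choice[OF this] obtain \<phi> where \<phi>: "\<And>n. \<phi> n \<in> formulas1 \<L> A"
      "\<And>n. E n = {a \<in> dom M. sat M (\<lambda>_. a) (\<phi> n)}"
    by auto
  have mono: "E n \<subseteq> E m" if "m \<le> n" for m n
    using lift_Suc_antimono_le[of E m n] dec that by blast
  have "finitely_satisfiable1 M (range \<phi>)"
    unfolding finitely_satisfiable1_def
  proof (intro allI impI, elim conjE)
    fix F assume F: "finite F" "F \<subseteq> range \<phi>"
    then obtain I where I: "finite I" "F = \<phi> ` I"
      by (meson finite_subset_image)
    obtain N where N: "\<And>i. i \<in> I \<Longrightarrow> i \<le> N"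
      using I(1) by (meson finite_nat_set_iff_bounded_le)
    obtain a where "a \<in> E N" using ne by blast
    then have "a \<in> E i" if "i \<in> I" for i using N[OF that] mono by blast
    then have "sat M (\<lambda>_. a) (\<phi> i)" if "i \<in> I" for i using that \<phi>(2)[of i] by blast
    moreover have "a \<in> dom M" using \<open>a \<in> E N\<close> \<phi>(2)[of N] by simp
    ultimately show "\<exists>a \<in> dom M. \<forall>\<psi> \<in> F. sat M (\<lambda>_. a) \<psi>"
      using I(2) by (intro bexI[of _ a]) simp_all
  qed
  then obtain q where "q \<in> complete_types1 \<L> M A" "range \<phi> \<subseteq> q"
    using finitely_satisfiable1_extends[of "range \<phi>" \<L> A M] \<phi>(1) by blast
  then show ?thesis using \<phi>(2) by blast
qed

lemma complete_type_sets_meet: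
  assumes "q \<in> complete_types1 \<L> M A" "\<phi> \<in> q" "\<psi> \<in> q"
  shows "{a \<in> dom M. sat M (\<lambda>_. a) \<phi>} \<inter> {a \<in> dom M. sat M (\<lambda>_. a) \<psi>} \<noteq> {}"
proof -
  have "finitely_satisfiable1 M q" using assms(1) unfolding complete_types1_def by simp
  moreover have "finite {\<phi>, \<psi>}" "{\<phi>, \<psi>} \<subseteq> q" using assms(2,3) by simp_all
  ultimately have "\<exists>a \<in> dom M. \<forall>\<chi> \<in> {\<phi>, \<psi>}. sat M (\<lambda>_. a) \<chi>"
    unfolding finitely_satisfiable1_def by meson
  then show ?thesis by auto
qed

text \<open>
  Splitting again and again turns every subset of \<open>\<nat>\<close> into a branch of a binary tree
  of definable sets. The sets along a branch lie in a common complete type, and different branches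
  pass through disjoint sets, so there would be as many types as subsets of \<open>\<nat>\<close>. This is
  the only way in which weak smallness enters the proof.
\<close>

proposition weakly_small_no_splitting_family:
  assumes ws: "weakly_small \<L> M" and A: "finite A" "A \<subseteq> dom M"
    and D0: "D0 \<in> \<D>"
    and def: "\<And>D. D \<in> \<D> \<Longrightarrow> definable \<L> M A D \<and> D \<noteq> {}"
    and split: "\<And>D. D \<in> \<D> \<Longrightarrow> \<exists>U \<in> \<D>. \<exists>W \<in> \<D>. U \<subseteq> D \<and> W \<subseteq> D \<and> U \<inter> W = {}"
  shows False
proof -
  from split obtain l r where lr: "\<And>D. D \<in> \<D> \<Longrightarrow>
      l D \<in> \<D> \<and> r D \<in> \<D> \<and> l D \<subseteq> D \<and> r D \<subseteq> D \<and> l D \<inter> r D = {}"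
    by metis
  define E where "E S = rec_nat D0 (\<lambda>n D. if n \<in> S then l D else r D)" for S :: "nat set"
  have E0: "E S 0 = D0" and ES: "E S (Suc n) = (if n \<in> S then l (E S n) else r (E S n))" for S n
    unfolding E_def by simp_all
  have E_in: "E S n \<in> \<D>" for S n
    by (induction n) (use D0 lr in \<open>auto simp: E0 ES\<close>)
  have "\<exists>q \<in> complete_types1 \<L> M A. \<forall>n. \<exists>\<phi> \<in> q. E S n = {a \<in> dom M. sat M (\<lambda>_. a) \<phi>}" for S
    using E_in def lr by (intro nested_definable_sets_in_type) (auto simp: ES)
  then have "\<forall>S. \<exists>q. q \<in> complete_types1 \<L> M A \<and>
      (\<forall>n. \<exists>\<phi> \<in> q. E S n = {a \<in> dom M. sat M (\<lambda>_. a) \<phi>})"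
    by blast
  from choice[OF this] obtain q where q: "\<And>S. q S \<in> complete_types1 \<L> M A"
      "\<And>S n. \<exists>\<phi> \<in> q S. E S n = {a \<in> dom M. sat M (\<lambda>_. a) \<phi>}"
    by blast
  (* Two branches split at the least number on which the two subsets disagree. *)
  have "inj q"
  proof (rule injI, rule ccontr)
    fix S T assume eq: "q S = q T" and "S \<noteq> T"
    define n where "n = (LEAST n. (n \<in> S) \<noteq> (n \<in> T))"
    have "\<exists>n. (n \<in> S) \<noteq> (n \<in> T)" using \<open>S \<noteq> T\<close> by blast
    then have n: "(n \<in> S) \<noteq> (n \<in> T)" unfolding n_def by (rule LeastI_ex)
    have less: "(m \<in> S) = (m \<in> T)" if "m < n" for m
      using not_less_Least that unfolding n_def by blast
    have "m \<le> n \<Longrightarrow> E S m = E T m" for m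
      by (induction m) (use less in \<open>auto simp: E0 ES\<close>)
    then have "E S (Suc n) \<inter> E T (Suc n) = {}"
      using n lr[OF E_in[of T n]] by (auto simp: ES)
    moreover obtain \<phi> \<psi> where "\<phi> \<in> q S" "E S (Suc n) = {a \<in> dom M. sat M (\<lambda>_. a) \<phi>}"
        "\<psi> \<in> q S" "E T (Suc n) = {a \<in> dom M. sat M (\<lambda>_. a) \<psi>}"
      using q(2)[of S "Suc n"] q(2)[of T "Suc n"] eq by auto
    ultimately show False
      using complete_type_sets_meet[OF q(1)[of S], of \<phi> \<psi>] by simp
  qed
  moreover have "countable (range q)"
    using ws A q(1) unfolding weakly_small_def by (meson countable_subset image_subsetI)
  ultimately have "countable (UNIV :: nat set set)"
    by (rule countable_image_inj_on[rotated])
  then obtain g :: "nat set \<Rightarrow> nat" where "inj g"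
    by (auto simp: countable_def)
  then have "surj (inv_into UNIV g)" by (rule inj_imp_surj_inv)
  then show False using Cantors_theorem[of "UNIV :: nat set"] by force
qed

subsection \<open>Building definable sets\<close>

text \<open>
  Definable sets are built semantically: \<open>definable_pred\<close> says that a predicate on
  assignments is expressed by some formula whose free variables lie in \<open>V\<close>, and
  \<open>term_map\<close> says the same of functions and terms. Closure under the connectives then
  replaces the syntactic manipulation of formulas.
\<close>

definition definable_pred ::
    "('f, 'r) language \<Rightarrow> ('f, 'r, 'a) fo_struct \<Rightarrow> 'a set \<Rightarrow> nat set \<Rightarrow> ((nat \<Rightarrow> 'a) \<Rightarrow> bool) \<Rightarrow> bool"
  where "definable_pred \<L> M A V P \<longleftrightarrow>
    (\<exists>\<phi>. wf_fm \<L> A \<phi> \<and> fv_fm \<phi> \<subseteq> V \<and> (\<forall>e. range e \<subseteq> dom M \<longrightarrow> sat M e \<phi> = P e))"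

definition term_map ::
    "('f, 'r) language \<Rightarrow> ('f, 'r, 'a) fo_struct \<Rightarrow> 'a set \<Rightarrow> nat set \<Rightarrow> ((nat \<Rightarrow> 'a) \<Rightarrow> 'a) \<Rightarrow> bool"
  where "term_map \<L> M A V F \<longleftrightarrow>
    (\<exists>t. wf_tm \<L> A t \<and> fv_tm t \<subseteq> V \<and> (\<forall>e. range e \<subseteq> dom M \<longrightarrow> eval_tm M e t = F e))"

lemma definable_pred_not:
  assumes "definable_pred \<L> M A V P" shows "definable_pred \<L> M A V (\<lambda>e. \<not> P e)"
proof -
  from assms obtain \<phi> where "wf_fm \<L> A \<phi> \<and> fv_fm \<phi> \<subseteq> V \<and> (\<forall>e. range e \<subseteq> dom M \<longrightarrow> sat M e \<phi> = P e)"
    unfolding definable_pred_def by blast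
  then show ?thesis unfolding definable_pred_def by (intro exI[of _ "Neg \<phi>"]) simp
qed

lemma definable_pred_conj:
  assumes "definable_pred \<L> M A V P" "definable_pred \<L> M A V Q"
  shows "definable_pred \<L> M A V (\<lambda>e. P e \<and> Q e)"
proof -
  from assms obtain \<phi> \<psi> where
    "wf_fm \<L> A \<phi> \<and> fv_fm \<phi> \<subseteq> V \<and> (\<forall>e. range e \<subseteq> dom M \<longrightarrow> sat M e \<phi> = P e)"
    "wf_fm \<L> A \<psi> \<and> fv_fm \<psi> \<subseteq> V \<and> (\<forall>e. range e \<subseteq> dom M \<longrightarrow> sat M e \<psi> = Q e)"
    unfolding definable_pred_def by blast
  then show ?thesis unfolding definable_pred_def by (intro exI[of _ "Conj \<phi> \<psi>"]) simp
qed

lemma definable_pred_ex: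
  assumes "definable_pred \<L> M A (insert n V) P"
  shows "definable_pred \<L> M A V (\<lambda>e. \<exists>a \<in> dom M. P (e(n := a)))"
proof -
  from assms obtain \<phi> where \<phi>: "wf_fm \<L> A \<phi>" "fv_fm \<phi> \<subseteq> insert n V"
      "\<And>e. range e \<subseteq> dom M \<Longrightarrow> sat M e \<phi> = P e"
    unfolding definable_pred_def by blast
  have "sat M (e(n := a)) \<phi> = P (e(n := a))" if "range e \<subseteq> dom M" "a \<in> dom M" for e a
    using that by (intro \<phi>(3)) auto
  with \<phi>(1,2) show ?thesis
    unfolding definable_pred_def by (intro exI[of _ "Exi n \<phi>"]) auto
qed

lemma definable_pred_eq:
  assumes "term_map \<L> M A V F" "term_map \<L> M A V G"
  shows "definable_pred \<L> M A V (\<lambda>e. F e = G e)"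
proof -
  from assms obtain s t where
    "wf_tm \<L> A s \<and> fv_tm s \<subseteq> V \<and> (\<forall>e. range e \<subseteq> dom M \<longrightarrow> eval_tm M e s = F e)"
    "wf_tm \<L> A t \<and> fv_tm t \<subseteq> V \<and> (\<forall>e. range e \<subseteq> dom M \<longrightarrow> eval_tm M e t = G e)"
    unfolding term_map_def by blast
  then show ?thesis unfolding definable_pred_def by (intro exI[of _ "Eq s t"]) simp
qed

text \<open>
  A formula that defines a set speaks about variable 0; substituting another variable for it
  would need renaming of bound variables. Binding variable 0 to the value of the other variable
  avoids this.
\<close>

lemma definable_pred_mem:
  assumes "definable \<L> M A D" and "n \<in> V"
  shows "definable_pred \<L> M A V (\<lambda>e. e n \<in> D)"
proof -
  from assms obtain \<phi> where \<phi>: "wf_fm \<L> A \<phi>" "fv_fm \<phi> \<subseteq> {0}"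
      "D = {a \<in> dom M. sat M (\<lambda>_. a) \<phi>}"
    unfolding definable_def formulas1_def by blast
  have *: "sat M e \<phi> \<longleftrightarrow> sat M (\<lambda>_. e 0) \<phi>" for e
    using \<phi>(2) by (intro sat_cong) auto
  show ?thesis
  proof (cases "n = 0")
    case True
    have "sat M e \<phi> \<longleftrightarrow> e n \<in> D" if "range e \<subseteq> dom M" for e
      using *[of e] that True \<phi>(3) by auto
    then show ?thesis
      using \<phi> True assms(2) unfolding definable_pred_def by blast
  next
    case False
    have "sat M e (Exi 0 (Conj (Eq (Var 0) (Var n)) \<phi>)) \<longleftrightarrow> e n \<in> D"
      if "range e \<subseteq> dom M" for e
      using *[of "e(0 := a)" for a] that False \<phi>(3) by (auto simp: image_subset_iff)
    then show ?thesis
      using \<phi>(1,2) False assms(2) unfolding definable_pred_def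
      by (intro exI[of _ "Exi 0 (Conj (Eq (Var 0) (Var n)) \<phi>)"]) auto
  qed
qed

lemma definable_Collect:
  assumes "definable_pred \<L> M A {0} P"
  shows "definable \<L> M A {a \<in> dom M. P (\<lambda>_. a)}"
proof -
  from assms obtain \<phi> where \<phi>: "wf_fm \<L> A \<phi>" "fv_fm \<phi> \<subseteq> {0}"
      "\<And>e. range e \<subseteq> dom M \<Longrightarrow> sat M e \<phi> = P e"
    unfolding definable_pred_def by (elim exE conjE) simp
  have "sat M (\<lambda>_. a) \<phi> = P (\<lambda>_. a)" if "a \<in> dom M" for a
    using that by (intro \<phi>(3)) auto
  then have "{a \<in> dom M. P (\<lambda>_. a)} = {a \<in> dom M. sat M (\<lambda>_. a) \<phi>}" by blast
  with \<phi>(1,2) show ?thesis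
    unfolding definable_def formulas1_def by (intro bexI[of _ \<phi>]) simp_all
qed

lemma definable_Int:
  assumes "definable \<L> M A D" "definable \<L> M A D'" shows "definable \<L> M A (D \<inter> D')"
proof -
  have "definable \<L> M A {a \<in> dom M. a \<in> D \<and> a \<in> D'}"
    using definable_Collect[OF definable_pred_conj[OF
        definable_pred_mem[OF assms(1)] definable_pred_mem[OF assms(2)]], of 0 0] by simp
  moreover have "{a \<in> dom M. a \<in> D \<and> a \<in> D'} = D \<inter> D'"
    using definable_subset[OF assms(1)] by blast
  ultimately show ?thesis by simp
qed

lemma definable_Diff:
  assumes "definable \<L> M A D" "definable \<L> M A D'" shows "definable \<L> M A (D - D')"
proof -
  have "definable \<L> M A {a \<in> dom M. a \<in> D \<and> a \<notin> D'}"
    using definable_Collect[OF definable_pred_conj[OF definable_pred_mem[OF assms(1)]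
        definable_pred_not[OF definable_pred_mem[OF assms(2)]]], of 0 0] by simp
  moreover have "{a \<in> dom M. a \<in> D \<and> a \<notin> D'} = D - D'"
    using definable_subset[OF assms(1)] by blast
  ultimately show ?thesis by simp
qed

lemma definable_Un:
  assumes "definable \<L> M A D" "definable \<L> M A D'" shows "definable \<L> M A (D \<union> D')"
proof -
  have "definable \<L> M A {a \<in> dom M. \<not> (a \<notin> D \<and> a \<notin> D')}"
    using definable_Collect[OF definable_pred_not[OF definable_pred_conj[OF
        definable_pred_not[OF definable_pred_mem[OF assms(1)]]
        definable_pred_not[OF definable_pred_mem[OF assms(2)]]]], of 0 0] by simp
  moreover have "{a \<in> dom M. \<not> (a \<notin> D \<and> a \<notin> D')} = D \<union> D'"
    using definable_subset[OF assms(1)] definable_subset[OF assms(2)] by blast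
  ultimately show ?thesis by simp
qed

lemma term_map_var: "n \<in> V \<Longrightarrow> term_map \<L> M A V (\<lambda>e. e n)"
  unfolding term_map_def by (intro exI[of _ "Var n"]) simp

lemma term_map_weaken:
  assumes "term_map \<L> M A V F" "V \<subseteq> V'" shows "term_map \<L> M A V' F"
proof -
  from assms(1) obtain t where "wf_tm \<L> A t \<and> fv_tm t \<subseteq> V \<and> (\<forall>e. range e \<subseteq> dom M \<longrightarrow> eval_tm M e t = F e)"
    unfolding term_map_def by (elim exE)
  with assms(2) show ?thesis unfolding term_map_def by (intro exI[of _ t]) auto
qed

lemma term_map_par: "a \<in> A \<Longrightarrow> term_map \<L> M A V (\<lambda>e. a)"
  unfolding term_map_def by (intro exI[of _ "Par a"]) simp

lemma definable_image:
  assumes "definable \<L> M A D" and "term_map \<L> M A {1} (\<lambda>e. f (e 1))"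
    and "f ` D \<subseteq> dom M"
  shows "definable \<L> M A (f ` D)"
proof -
  have tm: "term_map \<L> M A (insert 1 {0}) (\<lambda>e. f (e 1))"
    using assms(2) by (rule term_map_weaken) auto
  have "definable_pred \<L> M A (insert 1 {0}) (\<lambda>e. e 1 \<in> D \<and> e 0 = f (e 1))"
    by (intro definable_pred_conj definable_pred_mem assms(1) definable_pred_eq[OF _ tm] term_map_var) simp_all
  from definable_Collect[OF definable_pred_ex[OF this]]
  have "definable \<L> M A {x \<in> dom M. \<exists>a \<in> dom M. a \<in> D \<and> x = f a}" by simp
  moreover have "{x \<in> dom M. \<exists>a \<in> dom M. a \<in> D \<and> x = f a} = f ` D"
    using definable_subset[OF assms(1)] assms(3) by blast
  ultimately show ?thesis by simp
qed

lemma definable_image2: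
  assumes D: "definable \<L> M A D" "definable \<L> M A D'"
    and g: "term_map \<L> M A {1, 2} (\<lambda>e. g (e 1) (e 2))"
    and closed: "\<And>x y. x \<in> D \<Longrightarrow> y \<in> D' \<Longrightarrow> g x y \<in> dom M"
  shows "definable \<L> M A {g x y | x y. x \<in> D \<and> y \<in> D'}"
proof -
  have tm: "term_map \<L> M A (insert 2 (insert 1 {0})) (\<lambda>e. g (e 1) (e 2))"
    using g by (rule term_map_weaken) auto
  have "definable_pred \<L> M A (insert 2 (insert 1 {0}))
      (\<lambda>e. e 1 \<in> D \<and> e 2 \<in> D' \<and> e 0 = g (e 1) (e 2))"
    by (intro definable_pred_conj definable_pred_mem D definable_pred_eq[OF _ tm] term_map_var) simp_all
  from definable_Collect[OF definable_pred_ex[OF definable_pred_ex[OF this]]]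
  have "definable \<L> M A {x \<in> dom M. \<exists>a \<in> dom M. \<exists>b \<in> dom M. a \<in> D \<and> b \<in> D' \<and> x = g a b}"
    by simp
  moreover have "{x \<in> dom M. \<exists>a \<in> dom M. \<exists>b \<in> dom M. a \<in> D \<and> b \<in> D' \<and> x = g a b}
      = {g x y | x y. x \<in> D \<and> y \<in> D'}"
    using definable_subset[OF D(1)] definable_subset[OF D(2)] closed by blast
  ultimately show ?thesis by simp
qed

text \<open>
  For finite \<open>F\<close> this is an intersection of finitely many images. Quantifying over
  \<open>F\<close> inside the formula makes it definable from the parameters of \<open>F\<close> as a set;
  the single elements of \<open>F\<close> need not be definable.
\<close>

lemma definable_common_image:
  assumes F: "definable \<L> M A F" and g: "term_map \<L> M A {1, 2} (\<lambda>e. g (e 1) (e 2))"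
  shows "definable \<L> M A {x \<in> dom M. \<forall>b \<in> F. \<exists>y \<in> dom M. x = g b y}"
proof -
  have tm: "term_map \<L> M A (insert 2 (insert 1 {0})) (\<lambda>e. g (e 1) (e 2))"
    using g by (rule term_map_weaken) auto
  have "definable_pred \<L> M A (insert 2 (insert 1 {0})) (\<lambda>e. e 0 = g (e 1) (e 2))"
    by (intro definable_pred_eq[OF _ tm] term_map_var) simp_all
  from definable_pred_ex[OF this]
  have "definable_pred \<L> M A (insert 1 {0}) (\<lambda>e. \<exists>y \<in> dom M. e 0 = g (e 1) y)"
    by simp
  then have "definable_pred \<L> M A (insert 1 {0})
      (\<lambda>e. e 1 \<in> F \<and> \<not> (\<exists>y \<in> dom M. e 0 = g (e 1) y))"
    by (intro definable_pred_conj definable_pred_not definable_pred_mem F) auto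
  from definable_Collect[OF definable_pred_not[OF definable_pred_ex[OF this]]]
  have "definable \<L> M A {x \<in> dom M. \<not> (\<exists>b \<in> dom M. b \<in> F \<and> \<not> (\<exists>y \<in> dom M. x = g b y))}"
    by simp
  moreover have "{x \<in> dom M. \<not> (\<exists>b \<in> dom M. b \<in> F \<and> \<not> (\<exists>y \<in> dom M. x = g b y))}
      = {x \<in> dom M. \<forall>b \<in> F. \<exists>y \<in> dom M. x = g b y}"
    using definable_subset[OF F] by blast
  ultimately show ?thesis by simp
qed

lemma wf_tm_mono: "wf_tm \<L> A t \<Longrightarrow> A \<subseteq> A' \<Longrightarrow> wf_tm \<L> A' t"
  by (induction t) auto

lemma term_map_mono: "term_map \<L> M A V F \<Longrightarrow> A \<subseteq> A' \<Longrightarrow> term_map \<L> M A' V F"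
  unfolding term_map_def by (blast intro: wf_tm_mono)

section \<open>Algebraic closure\<close>

locale field_expansion = field K for K :: "'a ring" (structure) +
  fixes \<L> :: "('f field_sym, 'r) language" and M :: "('f field_sym, 'r, 'a) fo_struct"
  assumes expands: "expands_field \<L> M K"
begin

abbreviation "Def \<equiv> definable \<L> M"
abbreviation "Term \<equiv> term_map \<L> M"

lemma dom_eq [simp]: "dom M = carrier K"
  using expands unfolding expands_field_def by blast

lemma eval_tm_closed:
  assumes "wf_tm \<L> A t" "A \<subseteq> carrier K" "range e \<subseteq> carrier K"
  shows "eval_tm M e t \<in> carrier K"
  using assms
proof (induction t)
  case (Fn f ts)
  then have "set (map (eval_tm M e) ts) \<subseteq> carrier K" by auto
  with Fn.prems(1) show ?case
    using expands unfolding expands_field_def fo_structure_def by simp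
qed auto

lemma Term_add:
  assumes "A \<subseteq> carrier K" "Term A V F" "Term A V G" shows "Term A V (\<lambda>e. F e \<oplus> G e)"
proof -
  from assms obtain s t where
    st: "wf_tm \<L> A s \<and> fv_tm s \<subseteq> V \<and> (\<forall>e. range e \<subseteq> carrier K \<longrightarrow> eval_tm M e s = F e)"
    "wf_tm \<L> A t \<and> fv_tm t \<subseteq> V \<and> (\<forall>e. range e \<subseteq> carrier K \<longrightarrow> eval_tm M e t = G e)"
    unfolding term_map_def dom_eq by blast
  then have "F e \<in> carrier K \<and> G e \<in> carrier K" if "range e \<subseteq> carrier K" for e
    using eval_tm_closed[OF _ assms(1) that] that by metis
  with st expands show ?thesis
    unfolding term_map_def dom_eq expands_field_def
    by (intro exI[of _ "Fn AddS [s, t]"]) (auto simp del: dom_eq)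
qed

lemma Term_mult:
  assumes "A \<subseteq> carrier K" "Term A V F" "Term A V G" shows "Term A V (\<lambda>e. F e \<otimes> G e)"
proof -
  from assms obtain s t where
    st: "wf_tm \<L> A s \<and> fv_tm s \<subseteq> V \<and> (\<forall>e. range e \<subseteq> carrier K \<longrightarrow> eval_tm M e s = F e)"
    "wf_tm \<L> A t \<and> fv_tm t \<subseteq> V \<and> (\<forall>e. range e \<subseteq> carrier K \<longrightarrow> eval_tm M e t = G e)"
    unfolding term_map_def dom_eq by blast
  then have "F e \<in> carrier K \<and> G e \<in> carrier K" if "range e \<subseteq> carrier K" for e
    using eval_tm_closed[OF _ assms(1) that] that by metis
  with st expands show ?thesis
    unfolding term_map_def dom_eq expands_field_def
    by (intro exI[of _ "Fn MultS [s, t]"]) (auto simp del: dom_eq)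
qed

lemma Term_minus:
  assumes "A \<subseteq> carrier K" "Term A V F" shows "Term A V (\<lambda>e. \<ominus> F e)"
proof -
  from assms obtain s where
    st: "wf_tm \<L> A s \<and> fv_tm s \<subseteq> V \<and> (\<forall>e. range e \<subseteq> carrier K \<longrightarrow> eval_tm M e s = F e)"
    unfolding term_map_def dom_eq by blast
  then have "F e \<in> carrier K" if "range e \<subseteq> carrier K" for e
    using eval_tm_closed[OF _ assms(1) that] that by metis
  with st expands show ?thesis
    unfolding term_map_def dom_eq expands_field_def
    by (intro exI[of _ "Fn MinusS [s]"]) (auto simp del: dom_eq)
qed

lemma Term_one: "Term A V (\<lambda>e. \<one>)"
  using expands unfolding term_map_def expands_field_def
  by (intro exI[of _ "Fn OneS []"]) (auto simp del: dom_eq)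

lemma Term_zero: "Term A V (\<lambda>e. \<zero>)"
  using expands unfolding term_map_def expands_field_def
  by (intro exI[of _ "Fn ZeroS []"]) (auto simp del: dom_eq)

lemma Term_pow:
  assumes "A \<subseteq> carrier K" "Term A V F" shows "Term A V (\<lambda>e. F e [^] (n::nat))"
  by (induction n) (auto intro: Term_one Term_mult[OF assms(1) _ assms(2)])

lemma Def_singleton:
  assumes "a \<in> A" "a \<in> carrier K" shows "Def A {a}"
proof -
  have "definable_pred \<L> M A {0} (\<lambda>e. e 0 = a)"
    using assms by (intro definable_pred_eq term_map_var term_map_par) auto
  from definable_Collect[OF this] have "Def A {x \<in> carrier K. x = a}" by simp
  moreover have "{x \<in> carrier K. x = a} = {a}" using assms by blast
  ultimately show ?thesis by simp
qed

lemma Def_carrier: "Def A (carrier K)"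
proof -
  have "definable_pred \<L> M A {0} (\<lambda>e. e 0 = e 0)"
    by (intro definable_pred_eq term_map_var) auto
  from definable_Collect[OF this] show ?thesis by simp
qed

text \<open>
  The model-theoretic algebraic closure of \<open>A\<close> inside the structure.
\<close>

definition acl :: "'a set \<Rightarrow> 'a set" where
  "acl A = {x. \<exists>F. finite F \<and> Def A F \<and> x \<in> F}"

lemma aclI: "finite F \<Longrightarrow> Def A F \<Longrightarrow> x \<in> F \<Longrightarrow> x \<in> acl A"
  unfolding acl_def by blast

lemma aclE:
  assumes "x \<in> acl A" obtains F where "finite F" "Def A F" "x \<in> F"
  using assms unfolding acl_def by blast

lemma acl_closed: "x \<in> acl A \<Longrightarrow> x \<in> carrier K"
  using definable_subset unfolding acl_def by fastforce

lemma acl_par: "a \<in> A \<Longrightarrow> a \<in> carrier K \<Longrightarrow> a \<in> acl A"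
  by (rule aclI[OF _ Def_singleton]) auto

text \<open>
  If two elements range over finite \<open>A\<close>-definable sets, then the value of a definable
  operation at them ranges over the finite set of all values, which is again \<open>A\<close>-definable.
\<close>

lemma acl_binop:
  assumes "x \<in> acl A" "y \<in> acl A" and g: "Term A {1, 2} (\<lambda>e. g (e 1) (e 2))"
    and closed: "\<And>x y. x \<in> carrier K \<Longrightarrow> y \<in> carrier K \<Longrightarrow> g x y \<in> carrier K"
  shows "g x y \<in> acl A"
proof -
  from assms obtain F G where FG: "finite F" "Def A F" "x \<in> F" "finite G" "Def A G" "y \<in> G"
    by (meson aclE)
  have "{g x y | x y. x \<in> F \<and> y \<in> G} = (\<lambda>(x, y). g x y) ` (F \<times> G)" by auto
  then have "finite {g x y | x y. x \<in> F \<and> y \<in> G}" using FG by simp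
  moreover have "Def A {g x y | x y. x \<in> F \<and> y \<in> G}"
    using definable_subset[OF FG(2)] definable_subset[OF FG(5)]
    by (intro definable_image2 FG g) (auto intro: closed)
  ultimately show ?thesis using FG(3,6) by (intro aclI) auto
qed

lemma acl_add:
  assumes "A \<subseteq> carrier K" "x \<in> acl A" "y \<in> acl A" shows "x \<oplus> y \<in> acl A"
  using assms(2,3)
  by (rule acl_binop[where g = "\<lambda>x y. x \<oplus> y"]) (simp_all add: Term_add[OF assms(1)] term_map_var)

lemma acl_mult:
  assumes "A \<subseteq> carrier K" "x \<in> acl A" "y \<in> acl A" shows "x \<otimes> y \<in> acl A"
  using assms(2,3)
  by (rule acl_binop[where g = "\<lambda>x y. x \<otimes> y"]) (simp_all add: Term_mult[OF assms(1)] term_map_var)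

lemma acl_diff:
  assumes "A \<subseteq> carrier K" "x \<in> acl A" "y \<in> acl A" shows "x \<ominus> y \<in> acl A"
  unfolding a_minus_def using assms(2,3)
  by (rule acl_binop[where g = "\<lambda>x y. x \<oplus> \<ominus> y"])
    (simp_all add: Term_add[OF assms(1)] Term_minus[OF assms(1)] term_map_var)

lemma acl_inv:
  assumes "A \<subseteq> carrier K" "x \<in> acl A" "x \<noteq> \<zero>" shows "inv x \<in> acl A"
proof -
  from assms(2) obtain F where F: "finite F" "Def A F" "x \<in> F" by (rule aclE)
  define G where "G = {y \<in> carrier K. \<exists>x \<in> F. x \<otimes> y = \<one>}"
  have tm: "Term A (insert 1 {0}) (\<lambda>e. e 1 \<otimes> e 0)"
    by (intro Term_mult assms term_map_var) auto
  have "definable_pred \<L> M A (insert 1 {0}) (\<lambda>e. e 1 \<in> F \<and> e 1 \<otimes> e 0 = \<one>)"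
    by (intro definable_pred_conj definable_pred_mem definable_pred_eq[OF tm Term_one] F) simp
  from definable_Collect[OF definable_pred_ex[OF this]]
  have "Def A {y \<in> carrier K. \<exists>x \<in> carrier K. x \<in> F \<and> x \<otimes> y = \<one>}" by simp
  moreover have "{y \<in> carrier K. \<exists>x \<in> carrier K. x \<in> F \<and> x \<otimes> y = \<one>} = G"
    using definable_subset[OF F(2)] unfolding G_def by auto
  ultimately have "Def A G" by simp
  moreover have "G \<subseteq> (\<lambda>x. inv x) ` F"
  proof
    fix y assume "y \<in> G"
    then obtain x where x: "x \<in> F" "x \<otimes> y = \<one>" "y \<in> carrier K" unfolding G_def by blast
    then have "x \<in> carrier K" using definable_subset[OF F(2)] by auto
    then have "inv x = y" using x by (intro comm_inv_char) auto
    then show "y \<in> (\<lambda>x. inv x) ` F" using x(1) by blast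
  qed
  then have "finite G" using F(1) finite_surj by blast
  moreover have "x \<in> Units K" using assms(3) acl_closed[OF assms(2)] field_Units by blast
  then have "inv x \<in> G" unfolding G_def using F(3) Units_r_inv[of x] Units_inv_closed[of x] by blast
  ultimately show ?thesis by (intro aclI)
qed

section \<open>Chains of definable subgroups\<close>

lemma Def_set_add:
  assumes "A \<subseteq> carrier K" "Def A F" "Def A H" shows "Def A (F <+>\<^bsub>K\<^esub> H)"
proof -
  have "Term A {1, 2} (\<lambda>e. e 1 \<oplus> e 2)"
    by (simp add: Term_add[OF assms(1)] term_map_var)
  from definable_image2[OF assms(2,3) this]
  have "Def A {x \<oplus> y | x y. x \<in> F \<and> y \<in> H}"
    using definable_subset[OF assms(2)] definable_subset[OF assms(3)] by (simp add: subset_iff)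
  moreover have "F <+>\<^bsub>K\<^esub> H = {x \<oplus> y | x y. x \<in> F \<and> y \<in> H}"
    unfolding set_add_def' by blast
  ultimately show ?thesis by simp
qed

text \<open>
  The groups \<open>H n\<close> are definable over \<open>A\<close>, but their cosets in general are not. So the
  binary tree is made of sums of \<open>H n\<close> with finite \<open>A\<close>-definable sets \<open>F\<close>. If the
  traces on the algebraic closure descend strictly for ever, then so many classes modulo a late
  \<open>H m\<close> meet the trace of \<open>H n\<close> that the classes of the finitely many elements of
  \<open>F\<close> cannot cover \<open>F + (H n \<inter> acl A)\<close>. An algebraic element that is left over
  lies in a finite \<open>A\<close>-definable set, and this set yields a second, disjoint branch.
\<close>

proposition no_descending_chain_of_traces:
  assumes ws: "weakly_small \<L> M" and A: "finite A" "A \<subseteq> carrier K"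
    and def: "\<And>n. Def A (H n)" and sub: "\<And>n. additive_subgroup (H n) K"
    and dec: "\<And>n. H (Suc n) \<subseteq> H n"
  shows "\<exists>n. H n \<inter> acl A \<subseteq> H (Suc n)"
proof (rule ccontr)
  assume "\<not> ?thesis"
  then have "\<forall>n. \<exists>x. x \<in> acl A \<and> x \<in> H n \<and> x \<notin> H (Suc n)" by blast
  from choice[OF this] obtain g
    where g: "\<And>n. g n \<in> acl A" "\<And>n. g n \<in> H n" "\<And>n. g n \<notin> H (Suc n)" by blast
  have mono: "H n \<subseteq> H m" if "m \<le> n" for m n
    using lift_Suc_antimono_le[of H m n] dec that by blast
  have H_car: "H n \<subseteq> carrier K" for n
    using additive_subgroup.a_subset[OF sub] .
  have H_diff: "x \<ominus> y \<in> H n" if "x \<in> H n" "y \<in> H n" for x y n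
    using that additive_subgroup.a_closed[OF sub] additive_subgroup.a_inv_closed[OF sub]
    unfolding a_minus_def by blast
  define \<D> where "\<D> = {F <+>\<^bsub>K\<^esub> H n | F n. finite F \<and> F \<noteq> {} \<and> Def A F}"
  obtain F0 where F0: "finite F0" "Def A F0" "g 0 \<in> F0" using g(1) by (rule aclE)
  show False
  proof (rule weakly_small_no_splitting_family[OF ws, of A])
    show "F0 <+>\<^bsub>K\<^esub> H 0 \<in> \<D>" unfolding \<D>_def using F0 by blast
  next
    fix D assume "D \<in> \<D>"
    then obtain F n where F: "finite F" "F \<noteq> {}" "Def A F" "D = F <+>\<^bsub>K\<^esub> H n"
      unfolding \<D>_def by blast
    then show "Def A D \<and> D \<noteq> {}"
      using Def_set_add[OF A(2) F(3) def] g(2)[of n] unfolding set_add_def' by auto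
    have F_car: "F \<subseteq> carrier K" using definable_subset[OF F(3)] by simp
    define m where "m = Suc (n + card F)"
    (* Of the card F + 1 elements g i with i between n and n + card F, two would be congruent
       modulo H m by the pigeonhole principle, which their choice excludes. *)
    have "\<exists>c \<in> F. \<exists>h \<in> H n \<inter> acl A. c \<oplus> h \<notin> F <+>\<^bsub>K\<^esub> H m"
    proof (rule ccontr)
      assume none: "\<not> ?thesis"
      obtain c where c: "c \<in> F" using F(2) by blast
      have "\<exists>k u. k \<in> F \<and> u \<in> H m \<and> c \<oplus> g i = k \<oplus> u" if "i \<in> {n..n + card F}" for i
      proof -
        have "g i \<in> H n" using g(2)[of i] mono[of n i] that by auto
        then have "c \<oplus> g i \<in> F <+>\<^bsub>K\<^esub> H m" using none c g(1)[of i] by blast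
        then show ?thesis unfolding set_add_def' by blast
      qed
      then obtain k u where ku: "\<And>i. i \<in> {n..n + card F} \<Longrightarrow>
          k i \<in> F \<and> u i \<in> H m \<and> c \<oplus> g i = k i \<oplus> u i"
        by metis
      have "card (k ` {n..n + card F}) \<le> card F"
        using ku F(1) by (intro card_mono) auto
      then have "\<not> inj_on k {n..n + card F}"
        using card_image[of k "{n..n + card F}"] by auto
      then obtain i j where ij: "i < j" "i \<in> {n..n + card F}" "j \<in> {n..n + card F}" "k i = k j"
        unfolding inj_on_def by (metis linorder_neqE_nat)
      have car: "c \<in> carrier K" "k j \<in> carrier K" "g i \<in> carrier K" "g j \<in> carrier K"
          "u i \<in> carrier K" "u j \<in> carrier K"
        using c ku[OF ij(2)] ku[OF ij(3)] F_car H_car g(2) by blast+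
      have eqs: "c \<oplus> g i = k j \<oplus> u i" "c \<oplus> g j = k j \<oplus> u j"
        using ku[OF ij(2)] ku[OF ij(3)] ij(4) by simp_all
      have "g i = ((c \<oplus> g i) \<ominus> (c \<oplus> g j)) \<oplus> g j" using car by algebra
      also have "\<dots> = (u i \<ominus> u j) \<oplus> g j" unfolding eqs using car by algebra
      finally have "g i = (u i \<ominus> u j) \<oplus> g j" .
      moreover have "u i \<ominus> u j \<in> H (Suc i)"
        using H_diff ku[OF ij(2)] ku[OF ij(3)] mono[of "Suc i" m] ij(2) unfolding m_def by auto
      moreover have "g j \<in> H (Suc i)" using g(2)[of j] mono[of "Suc i" j] ij(1) by auto
      ultimately have "g i \<in> H (Suc i)"
        using additive_subgroup.a_closed[OF sub] by metis
      then show False using g(3) by blast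
    qed
    then obtain c h where c: "c \<in> F" "h \<in> H n" "h \<in> acl A" "c \<oplus> h \<notin> F <+>\<^bsub>K\<^esub> H m" by blast
    have "c \<oplus> h \<in> acl A"
      using acl_add[OF A(2) aclI[OF F(1,3) c(1)] c(3)] .
    then obtain F1 where F1: "finite F1" "Def A F1" "c \<oplus> h \<in> F1" by (rule aclE)
    define F2 where "F2 = (F1 \<inter> (F <+>\<^bsub>K\<^esub> H n)) - (F <+>\<^bsub>K\<^esub> H m)"
    have "c \<oplus> h \<in> F2" using c F1(3) unfolding F2_def set_add_def' by auto
    moreover have "Def A F2"
      unfolding F2_def using F1(2) F(3) def A(2)
      by (intro definable_Diff definable_Int Def_set_add)
    ultimately have F2: "finite F2" "F2 \<noteq> {}" "Def A F2" using F1(1) unfolding F2_def by auto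
    have F2_car: "F2 \<subseteq> carrier K" using definable_subset[OF F2(3)] by simp
    have mn: "H m \<subseteq> H n" using mono[of n m] unfolding m_def by simp
    have "F <+>\<^bsub>K\<^esub> H m \<subseteq> D" unfolding F(4) set_add_def' using mn by blast
    moreover have "F2 <+>\<^bsub>K\<^esub> H m \<subseteq> D"
    proof
      fix x assume "x \<in> F2 <+>\<^bsub>K\<^esub> H m"
      then obtain f a b where x: "x = (f \<oplus> a) \<oplus> b" "f \<in> F" "a \<in> H n" "b \<in> H m"
        unfolding F2_def set_add_def' by blast
      then have "x = f \<oplus> (a \<oplus> b)" using F_car H_car a_assoc by blast
      moreover have "a \<oplus> b \<in> H n" using x mn additive_subgroup.a_closed[OF sub] by blast
      ultimately show "x \<in> D" using x(2) unfolding F(4) set_add_def' by blast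
    qed
    moreover have "(F <+>\<^bsub>K\<^esub> H m) \<inter> (F2 <+>\<^bsub>K\<^esub> H m) = {}"
    proof (rule ccontr)
      assume "\<not> ?thesis"
      then obtain f a b y where x: "f \<in> F" "a \<in> H m" "y \<in> F2" "b \<in> H m" "f \<oplus> a = y \<oplus> b"
        unfolding set_add_def' by blast
      then have car: "f \<in> carrier K" "a \<in> carrier K" "y \<in> carrier K" "b \<in> carrier K"
        using F_car F2_car H_car by blast+
      have "y = (y \<oplus> b) \<ominus> b" using car by algebra
      also have "\<dots> = f \<oplus> (a \<ominus> b)" unfolding x(5)[symmetric] using car by algebra
      finally have "y \<in> F <+>\<^bsub>K\<^esub> H m" using x(1) H_diff[OF x(2,4)] unfolding set_add_def' by blast
      then show False using x(3) unfolding F2_def by blast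
    qed
    ultimately show "\<exists>U \<in> \<D>. \<exists>W \<in> \<D>. U \<subseteq> D \<and> W \<subseteq> D \<and> U \<inter> W = {}"
      using F(1-3) F2 unfolding \<D>_def by blast
  qed (use A in auto)
qed

end

section \<open>Polynomial functions and additive maps\<close>

text \<open>
  Finiteness of kernels is all that is needed from polynomials, so functions that are given by a
  polynomial are more convenient here than polynomials. Such a function is identified as nonzero
  by exhibiting a nonzero value.
\<close>

definition (in ring) polynomial_function :: "('a \<Rightarrow> 'a) \<Rightarrow> bool" where
  "polynomial_function f \<longleftrightarrow> (\<exists>p \<in> carrier (poly_ring R). \<forall>x \<in> carrier R. f x = eval p x)"

context domain
begin

lemma polynomial_function_closed: "polynomial_function f \<Longrightarrow> x \<in> carrier R \<Longrightarrow> f x \<in> carrier R"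
  using ring_hom_closed[OF eval_is_hom[OF carrier_is_subring]] unfolding polynomial_function_def by metis

lemma polynomial_function_id: "polynomial_function (\<lambda>x. x)"
  unfolding polynomial_function_def
  using var_closed(1)[OF carrier_is_subring] eval_var by (intro bexI[of _ "X\<^bsub>R\<^esub>"]) auto

lemma polynomial_function_const:
  assumes "c \<in> carrier R" shows "polynomial_function (\<lambda>x. c)"
proof (cases "c = \<zero>")
  case True
  then show ?thesis unfolding polynomial_function_def
    by (intro bexI[of _ "[]"]) (auto simp: univ_poly_carrier[symmetric] polynomial_def)
next
  case False
  then show ?thesis unfolding polynomial_function_def using assms
    by (intro bexI[of _ "[c]"]) (auto simp: univ_poly_carrier[symmetric] polynomial_def)
qed

lemma polynomial_function_add:
  assumes "polynomial_function f" "polynomial_function g"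
  shows "polynomial_function (\<lambda>x. f x \<oplus> g x)"
proof -
  interpret P: domain "poly_ring R" by (rule univ_poly_is_domain[OF carrier_is_subring])
  from assms obtain p q where "p \<in> carrier (poly_ring R)" "q \<in> carrier (poly_ring R)"
    "\<forall>x \<in> carrier R. f x = eval p x" "\<forall>x \<in> carrier R. g x = eval q x"
    unfolding polynomial_function_def by blast
  then show ?thesis unfolding polynomial_function_def
    by (intro bexI[of _ "p \<oplus>\<^bsub>poly_ring R\<^esub> q"])
      (auto simp: ring_hom_add[OF eval_is_hom[OF carrier_is_subring]])
qed

lemma polynomial_function_mult:
  assumes "polynomial_function f" "polynomial_function g"
  shows "polynomial_function (\<lambda>x. f x \<otimes> g x)"
proof -
  interpret P: domain "poly_ring R" by (rule univ_poly_is_domain[OF carrier_is_subring])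
  from assms obtain p q where "p \<in> carrier (poly_ring R)" "q \<in> carrier (poly_ring R)"
    "\<forall>x \<in> carrier R. f x = eval p x" "\<forall>x \<in> carrier R. g x = eval q x"
    unfolding polynomial_function_def by blast
  then show ?thesis unfolding polynomial_function_def
    by (intro bexI[of _ "p \<otimes>\<^bsub>poly_ring R\<^esub> q"])
      (auto simp: ring_hom_mult[OF eval_is_hom[OF carrier_is_subring]])
qed

lemma polynomial_function_pow:
  "polynomial_function f \<Longrightarrow> polynomial_function (\<lambda>x. f x [^] (n::nat))"
  by (induction n) (auto intro: polynomial_function_const polynomial_function_mult)

lemma polynomial_function_finite_zeros:
  assumes "polynomial_function f" "x \<in> carrier R" "f x \<noteq> \<zero>"
  shows "finite {x \<in> carrier R. f x = \<zero>}"
proof -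
  from assms(1) obtain p where p: "p \<in> carrier (poly_ring R)" "\<forall>x \<in> carrier R. f x = eval p x"
    unfolding polynomial_function_def by blast
  then have "p \<noteq> []" using assms(2,3) by auto
  then have "{x \<in> carrier R. f x = \<zero>} \<subseteq> {x. is_root p x}"
    using p(2) unfolding is_root_def by auto
  then show ?thesis using finite_number_of_roots[OF p(1)] finite_subset by blast
qed

lemma finite_roots_of_unity:
  assumes "0 < (n::nat)" shows "finite {x \<in> carrier R. x [^] n = \<one>}"
proof -
  have "finite {x \<in> carrier R. x [^] n \<oplus> \<ominus> \<one> = \<zero>}"
  proof (rule polynomial_function_finite_zeros[where x = \<zero>])
    show "polynomial_function (\<lambda>x. x [^] n \<oplus> \<ominus> \<one>)"
      by (intro polynomial_function_add polynomial_function_pow polynomial_function_id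
          polynomial_function_const) simp
    show "\<zero> [^] n \<oplus> \<ominus> \<one> \<noteq> \<zero>"
      using assms one_not_zero by (simp add: nat_pow_zero)
  qed simp
  moreover have "{x \<in> carrier R. x [^] n \<oplus> \<ominus> \<one> = \<zero>} = {x \<in> carrier R. x [^] n = \<one>}"
    using r_right_minus_eq unfolding a_minus_def by auto
  ultimately show ?thesis by simp
qed

lemma additive_subgroup_diffI:
  assumes "H \<subseteq> carrier R" "\<zero> \<in> H" "\<And>x y. x \<in> H \<Longrightarrow> y \<in> H \<Longrightarrow> x \<ominus> y \<in> H"
  shows "additive_subgroup H R"
proof -
  have neg: "\<ominus> y \<in> H" if "y \<in> H" for y
    using assms(3)[OF assms(2) that] assms(1) that by (auto simp: a_minus_def subset_iff)
  have "x \<oplus> y \<in> H" if "x \<in> H" "y \<in> H" for x y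
    using assms(3)[OF that(1) neg[OF that(2)]] assms(1) that by (auto simp: a_minus_def subset_iff)
  with neg assms show ?thesis
    by (intro additive_subgroupI add.subgroupI) auto
qed

end

locale additive_endomorphism = domain R for R :: "'a ring" (structure) +
  fixes f :: "'a \<Rightarrow> 'a"
  assumes f_closed: "x \<in> carrier R \<Longrightarrow> f x \<in> carrier R"
    and f_add: "x \<in> carrier R \<Longrightarrow> y \<in> carrier R \<Longrightarrow> f (x \<oplus> y) = f x \<oplus> f y"
begin

lemma f_zero: "f \<zero> = \<zero>"
  using f_add[of \<zero> \<zero>] f_closed[of \<zero>] by (metis add.r_cancel_one' zero_closed r_zero)

lemma f_diff:
  assumes "x \<in> carrier R" "y \<in> carrier R" shows "f (x \<ominus> y) = f x \<ominus> f y"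
proof -
  have "f x = f (x \<ominus> y) \<oplus> f y"
    using f_add[of "x \<ominus> y" y] assms by (metis minus_closed add.inv_solve_right' a_minus_def)
  moreover have "f (x \<ominus> y) \<in> carrier R" "f y \<in> carrier R" using assms by (auto intro: f_closed)
  ultimately show ?thesis by (simp add: a_minus_def a_assoc r_neg)
qed

lemma finite_fibre:
  assumes "finite {x \<in> carrier R. f x = \<zero>}"
  shows "finite {x \<in> carrier R. f x = y}"
proof (cases "\<exists>x0 \<in> carrier R. f x0 = y")
  case True
  then obtain x0 where x0: "x0 \<in> carrier R" "f x0 = y" by blast
  have "{x \<in> carrier R. f x = y} \<subseteq> (\<lambda>u. u \<oplus> x0) ` {x \<in> carrier R. f x = \<zero>}"
  proof
    fix x assume x: "x \<in> {x \<in> carrier R. f x = y}"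
    then have "f (x \<ominus> x0) = \<zero>" using f_diff x0 f_closed by (auto simp: a_minus_def r_neg)
    moreover have "x = (x \<ominus> x0) \<oplus> x0" using x x0(1) by (simp add: a_minus_def a_assoc l_neg)
    ultimately show "x \<in> (\<lambda>u. u \<oplus> x0) ` {x \<in> carrier R. f x = \<zero>}"
      using x x0(1) by (intro image_eqI[of _ _ "x \<ominus> x0"]) auto
  qed
  then show ?thesis using assms finite_surj by blast
next
  case False
  then have "{x \<in> carrier R. f x = y} = {}" by blast
  then show ?thesis by (simp only: finite.emptyI)
qed

lemma funpow: "additive_endomorphism R (f ^^ n)"
proof (induction n)
  case 0
  show ?case by unfold_locales simp_all
next
  case (Suc n)
  then interpret g: additive_endomorphism R "f ^^ n" .
  show ?case by unfold_locales (simp_all add: f_closed f_add g.f_closed g.f_add)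
qed

lemma finite_kernel_funpow:
  assumes "finite {x \<in> carrier R. f x = \<zero>}"
  shows "finite {x \<in> carrier R. (f ^^ n) x = \<zero>}"
proof (induction n)
  case 0
  have "{x \<in> carrier R. (f ^^ 0) x = \<zero>} \<subseteq> {\<zero>}" by auto
  then show ?case using finite_subset by blast
next
  case (Suc n)
  have "{x \<in> carrier R. (f ^^ Suc n) x = \<zero>}
      \<subseteq> (\<Union>y \<in> {x \<in> carrier R. (f ^^ n) x = \<zero>}. {x \<in> carrier R. f x = y})"
    using f_closed by (auto simp: funpow_swap1)
  then show ?case using Suc finite_fibre[OF assms] finite_subset by blast
qed

lemma image_additive_subgroup: "additive_subgroup (f ` carrier R) R"
proof (rule additive_subgroup_diffI)
  show "f ` carrier R \<subseteq> carrier R" using f_closed by blast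
  show "\<zero> \<in> f ` carrier R" using f_zero by (metis image_eqI zero_closed)
  show "x \<ominus> y \<in> f ` carrier R" if "x \<in> f ` carrier R" "y \<in> f ` carrier R" for x y
    using that f_diff by (metis (no_types, lifting) imageE image_eqI minus_closed)
qed

end

section \<open>Surjectivity of definable additive endomorphisms\<close>

context field_expansion
begin

lemma Def_zero: "Def A {\<zero>}"
proof -
  have "definable_pred \<L> M A {0} (\<lambda>e. e 0 = \<zero>)"
    by (intro definable_pred_eq term_map_var Term_zero) simp
  from definable_Collect[OF this] have "Def A {x \<in> carrier K. x = \<zero>}" by simp
  moreover have "{x \<in> carrier K. x = \<zero>} = {\<zero>}" by blast
  ultimately show ?thesis by simp
qed

lemma Def_roots_of_unity:
  assumes "A \<subseteq> carrier K" shows "Def A {x \<in> carrier K. x [^] (n::nat) = \<one>}"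
proof -
  have "definable_pred \<L> M A {0} (\<lambda>e. e 0 [^] n = \<one>)"
    by (intro definable_pred_eq Term_pow assms term_map_var Term_one) simp
  from definable_Collect[OF this] show ?thesis by simp
qed

text \<open>
  If \<open>acl A\<close> is finite, adjoin one element \<open>t\<close> outside it: a coincidence between two
  powers of \<open>t\<close> would make \<open>t\<close> a root of unity, hence algebraic over \<open>A\<close>. This
  covers the fields that are algebraic over their prime field together with all the others.
\<close>

lemma infinite_acl:
  assumes inf: "infinite (carrier K)" and A: "finite A" "A \<subseteq> carrier K"
  shows "\<exists>B. finite B \<and> A \<subseteq> B \<and> B \<subseteq> carrier K \<and> infinite (acl B)"
proof (cases "finite (acl A)")
  case True
  then have "infinite (carrier K - insert \<zero> (acl A))" using inf by simp
  then obtain t where t: "t \<in> carrier K" "t \<noteq> \<zero>" "t \<notin> acl A"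
    using infinite_imp_nonempty by blast
  define B where "B = insert t A"
  have B: "B \<subseteq> carrier K" using A t unfolding B_def by simp
  have tB: "t \<in> acl B" using t(1) by (intro acl_par) (simp_all add: B_def)
  have pow: "t [^] Suc n \<in> acl B" for n
  proof (induction n)
    case 0
    then show ?case using tB t(1) by simp
  next
    case (Suc n)
    then show ?case using acl_mult[OF B Suc tB] by simp
  qed
  have "inj (\<lambda>n. t [^] Suc n)"
  proof (rule linorder_injI)
    fix i j :: nat assume ij: "i < j"
    show "t [^] Suc i \<noteq> t [^] Suc j"
    proof
      assume eq: "t [^] Suc i = t [^] Suc j"
      have "t [^] Suc i \<otimes> \<one> = t [^] Suc i \<otimes> t [^] (j - i)"
        using eq ij t(1) nat_pow_mult[of t "Suc i" "j - i"] by simp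
      moreover have "t [^] k \<noteq> \<zero>" for k :: nat
        by (induction k) (use t(1,2) in \<open>simp_all add: integral_iff\<close>)
      ultimately have "t [^] (j - i) = \<one>"
        using t(1) m_lcancel[of "t [^] Suc i" \<one> "t [^] (j - i)"] by (metis nat_pow_closed one_closed)
      then have "t \<in> acl A"
        using finite_roots_of_unity[of "j - i"] Def_roots_of_unity[OF A(2), of "j - i"] ij t(1)
        by (intro aclI[of "{x \<in> carrier K. x [^] (j - i) = \<one>}"]) auto
      then show False using t(3) by blast
    qed
  qed
  then have "infinite (range (\<lambda>n. t [^] Suc n))" by (rule range_inj_infinite)
  moreover have "range (\<lambda>n. t [^] Suc n) \<subseteq> acl B" using pow by (rule image_subsetI)
  ultimately have "infinite (acl B)" by (meson infinite_super)
  then show ?thesis using A B unfolding B_def by (intro exI[of _ "insert t A"]) auto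
qed (use A in blast)

lemma acl_image:
  assumes "x \<in> acl A" "Term A {1} (\<lambda>e. f (e 1))" "\<And>x. x \<in> carrier K \<Longrightarrow> f x \<in> carrier K"
  shows "f x \<in> acl A"
proof -
  from assms(1) obtain F where F: "finite F" "Def A F" "x \<in> F" by (rule aclE)
  have "Def A (f ` F)"
    using definable_subset[OF F(2)] assms(3) by (intro definable_image F assms(2)) auto
  then show ?thesis using F by (intro aclI[of "f ` F"]) auto
qed

end

locale definable_endomorphism =
  field_expansion K \<L> M + additive_endomorphism K f
  for K :: "'a ring" (structure)
    and \<L> :: "('f field_sym, 'r) language" and M :: "('f field_sym, 'r, 'a) fo_struct"
    and f :: "'a \<Rightarrow> 'a" +
  fixes A :: "'a set"
  assumes ws: "weakly_small \<L> M" and A_fin: "finite A" and A_car: "A \<subseteq> carrier K"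
    and Term_f: "Term A {n} (\<lambda>e. f (e n))"
    and fin_ker: "finite {x \<in> carrier K. f x = \<zero>}"
begin

text \<open>
  The images of the iterates of \<open>f\<close> form a chain of definable subgroups, so their traces become
  stationary, say at \<open>n\<close>. Then \<open>f\<^sup>n x = f\<^sup>n (f y)\<close> for every algebraic
  \<open>x\<close> and a suitable \<open>y\<close>, and \<open>x - f y\<close> lies in the kernel of
  \<open>f\<^sup>n\<close>, which is finite. So the trace of the image of \<open>f\<close> has finite index in
  \<open>acl A\<close>.
\<close>

lemma finite_defect:
  "\<exists>E. finite E \<and> (\<forall>x \<in> acl A. \<exists>y \<in> carrier K. x \<ominus> f y \<in> E)"
proof -
  have Def_im: "Def A ((f ^^ n) ` carrier K)" for n
  proof (induction n)
    case 0
    show ?case using Def_carrier by simp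
  next
    case (Suc n)
    have "Def A (f ` (f ^^ n) ` carrier K)"
      using definable_subset[OF Suc] f_closed by (intro definable_image Suc Term_f) auto
    then show ?case by (simp add: image_comp)
  qed
  have "\<exists>n. (f ^^ n) ` carrier K \<inter> acl A \<subseteq> (f ^^ Suc n) ` carrier K"
  proof (rule no_descending_chain_of_traces[OF ws A_fin A_car])
    show "Def A ((f ^^ n) ` carrier K)" for n by (rule Def_im)
    show "additive_subgroup ((f ^^ n) ` carrier K) K" for n
      using additive_endomorphism.image_additive_subgroup[OF funpow] .
    show "(f ^^ Suc n) ` carrier K \<subseteq> (f ^^ n) ` carrier K" for n
      using f_closed by (auto simp: funpow_swap1)
  qed
  then obtain n where n: "(f ^^ n) ` carrier K \<inter> acl A \<subseteq> (f ^^ Suc n) ` carrier K" by blast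
  interpret fn: additive_endomorphism K "f ^^ n" by (rule funpow)
  have acl_fn: "(f ^^ m) x \<in> acl A" if "x \<in> acl A" for x m
    by (induction m) (use that in \<open>auto intro: acl_image[OF _ Term_f] f_closed\<close>)
  have "\<exists>y \<in> carrier K. x \<ominus> f y \<in> {x \<in> carrier K. (f ^^ n) x = \<zero>}" if x: "x \<in> acl A" for x
  proof -
    have xc: "x \<in> carrier K" using acl_closed[OF x] .
    then have "(f ^^ n) x \<in> (f ^^ Suc n) ` carrier K" using n acl_fn[OF x] by blast
    then obtain y where y: "y \<in> carrier K" "(f ^^ n) x = (f ^^ n) (f y)"
      by (auto simp: funpow_swap1)
    then have "(f ^^ n) (x \<ominus> f y) = \<zero>"
      using fn.f_diff[OF xc f_closed[OF y(1)]] fn.f_closed[OF f_closed[OF y(1)]]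
      by (simp add: a_minus_def r_neg)
    then show ?thesis using y(1) xc f_closed by (intro bexI[of _ y]) auto
  qed
  then show ?thesis using finite_kernel_funpow[OF fin_ker] by blast
qed

definition common_multiples :: "'a set \<Rightarrow> 'a set" where
  "common_multiples F = {x \<in> carrier K. \<forall>b \<in> F. \<exists>y \<in> carrier K. x = b \<otimes> f y}"

text \<open>
  Every element of the infinite set \<open>acl A\<close> has a defect in a fixed finite set with respect to
  each of the finitely many \<open>b \<in> F\<close>. Two elements with the same defects differ by a common
  multiple.
\<close>

lemma common_multiples_nonzero:
  assumes inf: "infinite (acl A)" and F: "finite F" "F \<subseteq> acl A - {\<zero>}"
  shows "\<exists>r \<in> acl A \<inter> common_multiples F. r \<noteq> \<zero>"
proof -
  from finite_defect obtain E
    where E: "finite E" "\<forall>x \<in> acl A. \<exists>y \<in> carrier K. x \<ominus> f y \<in> E" by blast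
  have "\<forall>x \<in> acl A. \<exists>y. y \<in> carrier K \<and> x \<ominus> f y \<in> E" using E(2) by blast
  from bchoice[OF this] obtain y
    where y: "\<And>x. x \<in> acl A \<Longrightarrow> y x \<in> carrier K" "\<And>x. x \<in> acl A \<Longrightarrow> x \<ominus> f (y x) \<in> E" by blast
  define d where "d x = (\<lambda>b \<in> F. inv b \<otimes> x \<ominus> f (y (inv b \<otimes> x)))" for x
  have quot: "inv b \<otimes> x \<in> acl A" if "b \<in> F" "x \<in> acl A" for b x
    using that F(2) by (intro acl_mult acl_inv A_car) auto
  have "d ` acl A \<subseteq> F \<rightarrow>\<^sub>E E" using y(2) quot unfolding d_def by auto
  then have "finite (d ` acl A)" using finite_PiE[OF F(1)] E(1) finite_subset by meson
  from pigeonhole_infinite[OF inf this] obtain a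
    where a: "a \<in> acl A" "infinite {x \<in> acl A. d x = d a}" by blast
  then have "infinite ({x \<in> acl A. d x = d a} - {a})" by simp
  then obtain x where x: "x \<in> acl A" "d x = d a" "x \<noteq> a"
    using infinite_imp_nonempty by blast
  have car: "x \<in> carrier K" "a \<in> carrier K" using a(1) x(1) acl_closed by auto
  have "\<exists>u \<in> carrier K. x \<ominus> a = b \<otimes> f u" if b: "b \<in> F" for b
  proof -
    have bc: "b \<in> carrier K" "b \<noteq> \<zero>" using b F(2) acl_closed by auto
    then have bi: "inv b \<in> carrier K" "b \<otimes> inv b = \<one>" using field_Units by auto
    define v where "v = y (inv b \<otimes> x)"
    define w where "w = y (inv b \<otimes> a)"
    have vw: "v \<in> carrier K" "w \<in> carrier K"
      unfolding v_def w_def using y(1) quot b a(1) x(1) by auto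
    note fvw = f_closed[OF vw(1)] f_closed[OF vw(2)]
    have eq: "inv b \<otimes> x \<ominus> f v = inv b \<otimes> a \<ominus> f w"
      using fun_cong[OF x(2), of b] b unfolding d_def v_def w_def by simp
    have "b \<otimes> f (v \<ominus> w) = b \<otimes> (f v \<ominus> f w)" using f_diff[OF vw] by simp
    also have "\<dots> = b \<otimes> ((inv b \<otimes> x \<ominus> (inv b \<otimes> x \<ominus> f v)) \<ominus> f w)"
      using car bc(1) bi(1) fvw by algebra
    also have "\<dots> = (b \<otimes> inv b) \<otimes> (x \<ominus> a)"
      unfolding eq using car bc(1) bi(1) fvw by algebra
    also have "\<dots> = x \<ominus> a" unfolding bi(2) using car by simp
    finally show ?thesis using vw by (intro bexI[of _ "v \<ominus> w"]) auto
  qed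
  then have "x \<ominus> a \<in> common_multiples F" unfolding common_multiples_def using car by auto
  moreover have "x \<ominus> a \<in> acl A" using a(1) x(1) A_car by (intro acl_diff)
  moreover have "x \<ominus> a \<noteq> \<zero>" using x(3) car r_right_minus_eq by blast
  ultimately show ?thesis by blast
qed

lemma Def_common_multiples:
  assumes "Def A F" shows "Def A (common_multiples F)"
proof -
  have "Term A {1, 2} (\<lambda>e. e 1 \<otimes> f (e 2))"
    by (intro Term_mult A_car term_map_var term_map_weaken[OF Term_f]) auto
  from definable_common_image[OF assms this] show ?thesis
    unfolding common_multiples_def by simp
qed

lemma common_multiples_additive_subgroup:
  assumes "F \<subseteq> carrier K" shows "additive_subgroup (common_multiples F) K"
proof (rule additive_subgroup_diffI)
  show "common_multiples F \<subseteq> carrier K" unfolding common_multiples_def by blast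
  have "\<exists>y \<in> carrier K. \<zero> = b \<otimes> f y" if "b \<in> F" for b
    using assms that f_zero by (intro bexI[of _ \<zero>]) auto
  then show "\<zero> \<in> common_multiples F" unfolding common_multiples_def by simp
  fix x x' assume x: "x \<in> common_multiples F" "x' \<in> common_multiples F"
  have "\<exists>y \<in> carrier K. x \<ominus> x' = b \<otimes> f y" if b: "b \<in> F" for b
  proof -
    from x b obtain y y' where y: "y \<in> carrier K" "y' \<in> carrier K" "x = b \<otimes> f y" "x' = b \<otimes> f y'"
      unfolding common_multiples_def by blast
    have "b \<in> carrier K" using b assms by blast
    then have "b \<otimes> f y \<ominus> b \<otimes> f y' = b \<otimes> (f y \<ominus> f y')"
      using f_closed[OF y(1)] f_closed[OF y(2)] by algebra
    then have "x \<ominus> x' = b \<otimes> f (y \<ominus> y')" unfolding y(3,4) using f_diff y(1,2) by simp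
    then show ?thesis using y(1,2) by blast
  qed
  then show "x \<ominus> x' \<in> common_multiples F" using x unfolding common_multiples_def by simp
qed

text \<open>
  The groups \<open>common_multiples F\<close> with \<open>F\<close> finite and \<open>A\<close>-definable are again
  definable subgroups, so one of them has a smallest trace. A nonzero element \<open>r\<close> of this
  trace is then of the form \<open>b f(y)\<close> for every nonzero \<open>b\<close> in \<open>acl A\<close>;
  the choice \<open>b = r / c\<close> gives \<open>c = f(y)\<close>.
\<close>

lemma acl_subset_image:
  assumes inf: "infinite (acl A)" and c: "c \<in> acl A"
  shows "c \<in> f ` carrier K"
proof (cases "c = \<zero>")
  case True
  then show ?thesis using f_zero by (metis image_eqI zero_closed)
next
  case False
  define \<F> where "\<F> = {F. finite F \<and> Def A F \<and> \<zero> \<notin> F}"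
  have F_sub: "F \<subseteq> acl A - {\<zero>}" "F \<subseteq> carrier K" if "F \<in> \<F>" for F
    using that definable_subset[of \<L> M A F] aclI unfolding \<F>_def by auto
  have "\<exists>F \<in> \<F>. \<forall>b \<in> acl A - {\<zero>}. common_multiples F \<inter> acl A \<subseteq> common_multiples {b}"
  proof (rule ccontr)
    assume neg: "\<not> ?thesis"
    have step: "\<exists>F'. F' \<in> \<F> \<and> F \<subseteq> F' \<and> \<not> (common_multiples F \<inter> acl A \<subseteq> common_multiples F')"
      if F: "F \<in> \<F>" for F
    proof -
      from neg F obtain b where b: "b \<in> acl A" "b \<noteq> \<zero>"
          "\<not> (common_multiples F \<inter> acl A \<subseteq> common_multiples {b})" by blast
      from b(1) obtain G where G: "finite G" "Def A G" "b \<in> G" by (rule aclE)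
      define F' where "F' = F \<union> (G - {\<zero>})"
      have "F' \<in> \<F>" using F G Def_zero unfolding F'_def \<F>_def
        by (auto intro: definable_Un definable_Diff)
      moreover have "common_multiples F' \<subseteq> common_multiples {b}"
        using G(3) b(2) unfolding F'_def common_multiples_def by auto
      ultimately show ?thesis using b(3) unfolding F'_def by blast
    qed
    have "\<exists>S. \<forall>n. S n \<in> \<F> \<and> (S n \<subseteq> S (Suc n) \<and>
        \<not> (common_multiples (S n) \<inter> acl A \<subseteq> common_multiples (S (Suc n))))"
    proof (rule dependent_nat_choice)
      have "Def A ({\<zero>} - {\<zero>})" by (intro definable_Diff Def_zero)
      then show "\<exists>F. F \<in> \<F>" unfolding \<F>_def by (intro exI[of _ "{}"]) simp
    qed (use step in blast)
    then obtain S where S: "\<And>n. S n \<in> \<F>" "\<And>n. S n \<subseteq> S (Suc n)"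
        "\<And>n. \<not> (common_multiples (S n) \<inter> acl A \<subseteq> common_multiples (S (Suc n)))"
      by blast
    have "\<exists>n. common_multiples (S n) \<inter> acl A \<subseteq> common_multiples (S (Suc n))"
    proof (rule no_descending_chain_of_traces[OF ws A_fin A_car])
      show "Def A (common_multiples (S n))" for n
        using S(1)[of n] by (intro Def_common_multiples) (simp add: \<F>_def)
      show "additive_subgroup (common_multiples (S n)) K" for n
        using F_sub(2)[OF S(1)] by (rule common_multiples_additive_subgroup)
      show "common_multiples (S (Suc n)) \<subseteq> common_multiples (S n)" for n
        using S(2)[of n] unfolding common_multiples_def by blast
    qed
    then show False using S(3) by blast
  qed
  then obtain F where F: "F \<in> \<F>"
      "\<And>b. b \<in> acl A - {\<zero>} \<Longrightarrow> common_multiples F \<inter> acl A \<subseteq> common_multiples {b}" by blast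
  from common_multiples_nonzero[OF inf _ F_sub(1)[OF F(1)]] F(1) obtain r
    where r: "r \<in> acl A" "r \<in> common_multiples F" "r \<noteq> \<zero>" unfolding \<F>_def by blast
  have car: "c \<in> carrier K" "r \<in> carrier K" using c r(1) acl_closed by auto
  have ci: "inv c \<in> carrier K" "inv c \<otimes> c = \<one>" "inv c \<noteq> \<zero>"
    using car(1) False field_Units nonzero_imp_inverse_nonzero by auto
  define b where "b = r \<otimes> inv c"
  have b: "b \<in> acl A" "b \<noteq> \<zero>" "b \<in> carrier K"
    unfolding b_def using acl_mult[OF A_car r(1) acl_inv[OF A_car c False]] r(3) car ci integral
    by auto
  then obtain y where y: "y \<in> carrier K" "r = b \<otimes> f y"
    using F(2)[of b] r(1,2) unfolding common_multiples_def by blast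
  have "b \<otimes> c = r \<otimes> (inv c \<otimes> c)" unfolding b_def using car ci(1) by (simp add: m_assoc)
  then have "b \<otimes> c = b \<otimes> f y" using y(2) ci(2) car by simp
  then have "c = f y" using m_lcancel[OF b(2,3) car(1) f_closed[OF y(1)]] by simp
  then show ?thesis using y(1) by blast
qed

end

text \<open>
  To hit \<open>c\<close>, add \<open>c\<close> and, if necessary, one further element to the parameters, so
  that \<open>c\<close> becomes algebraic over them and the algebraic closure becomes infinite.
\<close>

theorem (in field_expansion) additive_endomorphism_surjective:
  assumes ws: "weakly_small \<L> M" and inf: "infinite (carrier K)"
    and A: "finite A" "A \<subseteq> carrier K"
    and f: "additive_endomorphism K f" "\<And>n. Term A {n} (\<lambda>e. f (e n))"
    and ker: "finite {x \<in> carrier K. f x = \<zero>}"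
  shows "f ` carrier K = carrier K"
proof
  interpret f: additive_endomorphism K f by (rule f)
  show "f ` carrier K \<subseteq> carrier K" using f.f_closed by blast
  show "carrier K \<subseteq> f ` carrier K"
  proof
    fix c assume c: "c \<in> carrier K"
    obtain B where B: "finite B" "insert c A \<subseteq> B" "B \<subseteq> carrier K" "infinite (acl B)"
      using infinite_acl[OF inf, of "insert c A"] A c by auto
    interpret definable_endomorphism K \<L> M f B
      using ws B f(2) ker by unfold_locales (auto intro: term_map_mono)
    show "c \<in> f ` carrier K" using acl_subset_image[OF B(4)] acl_par[of c B] c B(2) by blast
  qed
qed

section \<open>Prime characteristic\<close>

lemma (in cring) binomial_theorem:
  assumes x: "x \<in> carrier R" and y: "y \<in> carrier R"
  shows "(x \<oplus> y) [^] n = (\<Oplus>k \<in> {..n}. [(n choose k)] \<cdot> (x [^] k \<otimes> y [^] (n - k)))"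
proof (induction n)
  case 0
  show ?case by simp
next
  case (Suc n)
  define t where "t k = [(n choose k)] \<cdot> (x [^] k \<otimes> y [^] (n - k))" for k
  (* The two summands of (x + y)^n (x + y), both indexed by {..Suc n}, so that Pascal's rule
     applies termwise; the extra terms a 0 and b (Suc n) vanish. *)
  define a where "a k = (if k = 0 then \<zero> else [(n choose (k - 1))] \<cdot> (x [^] k \<otimes> y [^] (Suc n - k)))" for k
  define b where "b k = [(n choose k)] \<cdot> (x [^] k \<otimes> y [^] (Suc n - k))" for k
  have t: "t \<in> {..n} \<rightarrow> carrier R" unfolding t_def using x y by auto
  have a: "a \<in> A \<rightarrow> carrier R" for A unfolding a_def using x y by auto
  have b: "b \<in> A \<rightarrow> carrier R" for A unfolding b_def using x y by auto
  have a0: "a 0 = \<zero>" and bn: "b (Suc n) = \<zero>" unfolding a_def b_def by (simp_all add: binomial_eq_0)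
  have "(\<Oplus>k \<in> {..n}. t k) \<otimes> x = (\<Oplus>k \<in> {..n}. t k \<otimes> x)"
    using x t by (intro finsum_ldistr) auto
  also have "\<dots> = (\<Oplus>k \<in> {..n}. a (Suc k))"
  proof (rule finsum_cong')
    fix k assume "k \<in> {..n}"
    have "x [^] k \<otimes> y [^] (n - k) \<otimes> x = x [^] Suc k \<otimes> y [^] (n - k)"
      using x y by (simp add: m_ac)
    then show "t k \<otimes> x = a (Suc k)"
      unfolding t_def a_def using x y by (simp add: add_pow_ldistr)
  qed (use a in auto)
  also have "\<dots> = (\<Oplus>k \<in> {..n}. a (Suc k)) \<oplus> a 0"
    using finsum_closed[of "\<lambda>k. a (Suc k)" "{..n}"] a[of UNIV] by (simp add: a0 Pi_def)
  also have "\<dots> = (\<Oplus>k \<in> {..Suc n}. a k)" by (rule finsum_Suc2[OF a, symmetric])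
  finally have 1: "(\<Oplus>k \<in> {..n}. t k) \<otimes> x = (\<Oplus>k \<in> {..Suc n}. a k)" .
  have "(\<Oplus>k \<in> {..n}. t k) \<otimes> y = (\<Oplus>k \<in> {..n}. t k \<otimes> y)"
    using y t by (intro finsum_ldistr) auto
  also have "\<dots> = (\<Oplus>k \<in> {..n}. b k)"
  proof (rule finsum_cong')
    fix k assume "k \<in> {..n}"
    then have "Suc n - k = Suc (n - k)" by auto
    then have "x [^] k \<otimes> y [^] (n - k) \<otimes> y = x [^] k \<otimes> y [^] (Suc n - k)"
      using x y by (simp add: m_assoc)
    then show "t k \<otimes> y = b k"
      unfolding t_def b_def using x y by (simp add: add_pow_ldistr)
  qed (use b in auto)
  also have "\<dots> = b (Suc n) \<oplus> (\<Oplus>k \<in> {..n}. b k)"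
    using finsum_closed[of b "{..n}"] b[of UNIV] by (simp add: bn Pi_def)
  also have "\<dots> = (\<Oplus>k \<in> {..Suc n}. b k)" by (rule finsum_Suc[OF b, symmetric])
  finally have 2: "(\<Oplus>k \<in> {..n}. t k) \<otimes> y = (\<Oplus>k \<in> {..Suc n}. b k)" .
  have "(x \<oplus> y) [^] Suc n = (\<Oplus>k \<in> {..n}. t k) \<otimes> (x \<oplus> y)"
    using Suc unfolding t_def by simp
  also have "\<dots> = (\<Oplus>k \<in> {..Suc n}. a k) \<oplus> (\<Oplus>k \<in> {..Suc n}. b k)"
    using 1 2 x y t by (simp add: r_distr)
  also have "\<dots> = (\<Oplus>k \<in> {..Suc n}. a k \<oplus> b k)"
    using a b by (intro finsum_addf[symmetric]) auto
  also have "\<dots> = (\<Oplus>k \<in> {..Suc n}. [(Suc n choose k)] \<cdot> (x [^] k \<otimes> y [^] (Suc n - k)))"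
  proof (rule finsum_cong')
    fix k
    show "a k \<oplus> b k = [(Suc n choose k)] \<cdot> (x [^] k \<otimes> y [^] (Suc n - k))"
    proof (cases k)
      case 0
      then show ?thesis unfolding a_def b_def using x y by simp
    next
      case (Suc j)
      then show ?thesis unfolding a_def b_def using x y by (simp add: add.nat_pow_mult)
    qed
  qed (use x y in auto)
  finally show ?case .
qed

locale domain_positive_characteristic = domain R for R :: "'a ring" (structure) +
  assumes characteristic_pos: "characteristic R > 0"
begin

lemma characteristic_multiple_one: "[characteristic R] \<cdot> \<one> = \<zero>"
proof -
  have ex: "\<exists>n::nat. 0 < n \<and> [n] \<cdot> \<one> = \<zero>"
    using characteristic_pos unfolding characteristic_def by (auto split: if_splits)
  from LeastI_ex[OF ex] ex show ?thesis unfolding characteristic_def by simp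
qed

lemma characteristic_least:
  assumes "0 < n" "[(n::nat)] \<cdot> \<one> = \<zero>" shows "characteristic R \<le> n"
proof -
  have ex: "\<exists>n::nat. 0 < n \<and> [n] \<cdot> \<one> = \<zero>" using assms by blast
  show "characteristic R \<le> n"
    unfolding characteristic_def using ex assms Least_le[of "\<lambda>n. 0 < n \<and> [n] \<cdot> \<one> = \<zero>" n] by simp
qed

lemma add_pow_mult_one:
  "[(m * n :: nat)] \<cdot> \<one> = ([m] \<cdot> \<one>) \<otimes> ([n] \<cdot> \<one>)"
  by (simp add: add_pow_ldistr add.nat_pow_pow mult.commute)

lemma prime_characteristic: "Factorial_Ring.prime (characteristic R)"
proof -
  let ?p = "characteristic R"
  have "?p \<noteq> 1" using characteristic_multiple_one by (metis add.nat_pow_eone one_closed one_not_zero)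
  moreover have "?p = n" if n: "n dvd ?p" "n \<noteq> 1" for n
  proof -
    from n(1) obtain m where m: "?p = m * n" by (metis dvd_div_mult_self)
    have pos': "0 < m" "0 < n" using m characteristic_pos by auto
    have "([m] \<cdot> \<one>) \<otimes> ([n] \<cdot> \<one>) = \<zero>"
      using characteristic_multiple_one unfolding m add_pow_mult_one .
    then have "[m] \<cdot> \<one> = \<zero> \<or> [n] \<cdot> \<one> = \<zero>" by (simp add: integral_iff)
    then have "?p \<le> m \<or> ?p \<le> n" using characteristic_least pos' by blast
    moreover have "m < m * n" using n(2) pos' by simp
    ultimately have "m * n \<le> n" using m by linarith
    then have "m = 1" using pos' by simp
    then show ?thesis using m by simp
  qed
  ultimately show ?thesis unfolding prime_nat_iff using characteristic_pos by (auto simp: Suc_lessI)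
qed

lemma characteristic_multiple:
  assumes "x \<in> carrier R" "characteristic R dvd n"
  shows "[n] \<cdot> x = \<zero>"
proof -
  from assms(2) obtain m where m: "n = characteristic R * m" by blast
  have "[n] \<cdot> x = [m] \<cdot> ([characteristic R] \<cdot> (\<one> \<otimes> x))"
    using assms(1) by (simp add: m add.nat_pow_pow)
  also have "[characteristic R] \<cdot> (\<one> \<otimes> x) = ([characteristic R] \<cdot> \<one>) \<otimes> x"
    using assms(1) by (subst add_pow_ldistr) auto
  finally show ?thesis
    using assms(1) characteristic_multiple_one by (simp add: add.nat_pow_one)
qed

text \<open>
  All binomial coefficients but the outer two are divisible by the characteristic, which is prime.
\<close>

lemma frobenius_add:
  assumes x: "x \<in> carrier R" and y: "y \<in> carrier R"
  shows "(x \<oplus> y) [^] characteristic R = x [^] characteristic R \<oplus> y [^] characteristic R"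
proof -
  define p where "p = characteristic R"
  have prime: "Factorial_Ring.prime p" unfolding p_def by (rule prime_characteristic)
  define r where "r = p - 2"
  have r: "p = Suc (Suc r)" using prime_ge_2_nat[OF prime] unfolding r_def by simp
  define t where "t k = [(p choose k)] \<cdot> (x [^] k \<otimes> y [^] (p - k))" for k
  have t: "t k \<in> carrier R" for k unfolding t_def using x y by auto
  have mid: "t (Suc k) = \<zero>" if "k \<in> {..r}" for k
    unfolding t_def
  proof (rule characteristic_multiple)
    have "p dvd (p choose Suc k)"
      using that prime r by (intro dvd_choose_prime) auto
    then show "characteristic R dvd (p choose Suc k)" unfolding p_def .
  qed (use x y in auto)
  have "(\<Oplus>k \<in> {..r}. t (Suc k)) = \<zero>"
    using mid by (intro add.finprod_one_eqI) auto
  then have "(\<Oplus>k \<in> {..Suc r}. t k) = t 0"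
    using finsum_Suc2[of t r] t by (simp add: Pi_def del: finsum_Suc)
  then have "(\<Oplus>k \<in> {..p}. t k) = t p \<oplus> t 0"
    unfolding r using finsum_Suc[of t "Suc r"] t by (simp add: Pi_def del: finsum_Suc)
  also have "\<dots> = x [^] p \<oplus> y [^] p" unfolding t_def using x y by simp
  finally show ?thesis
    using binomial_theorem[OF x y, of p] unfolding t_def p_def by simp
qed

lemma additive_endomorphism_frobenius: "additive_endomorphism R (\<lambda>x. x [^] characteristic R)"
  by unfold_locales (simp_all add: frobenius_add)

end

lemma characteristic_hom:
  fixes K :: "'a ring" and L :: "'b ring"
  assumes K: "field K" and L: "field L" and h: "h \<in> ring_hom K L"
  shows "characteristic L = characteristic K"
proof -
  interpret K: field K by (rule K)
  interpret L: field L by (rule L)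
  interpret h: ring_hom_ring K L h
    using h by (intro ring_hom_ringI2 K.ring_axioms L.ring_axioms)
  have mult: "h ([(n::nat)] \<cdot>\<^bsub>K\<^esub> \<one>\<^bsub>K\<^esub>) = [n] \<cdot>\<^bsub>L\<^esub> \<one>\<^bsub>L\<^esub>" for n
    by (induction n) simp_all
  have inj: "inj_on h (carrier K)"
    using h.img_is_subfield(1)[OF K.carrier_is_subfield] L.one_not_zero by simp
  have "[(n::nat)] \<cdot>\<^bsub>L\<^esub> \<one>\<^bsub>L\<^esub> = \<zero>\<^bsub>L\<^esub> \<longleftrightarrow> [n] \<cdot>\<^bsub>K\<^esub> \<one>\<^bsub>K\<^esub> = \<zero>\<^bsub>K\<^esub>" for n
    unfolding mult[symmetric] using inj
    by (metis K.add.nat_pow_closed K.one_closed K.zero_closed h.hom_zero inj_onD)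
  then show ?thesis unfolding characteristic_def by (simp only:)
qed

section \<open>Artin-Schreier equations over algebraic extensions\<close>

context ring
begin

lemma finsum_lessThan_Suc:
  assumes "\<And>i. f i \<in> carrier R"
  shows "(\<Oplus>i \<in> {..<Suc k}. f i) = (\<Oplus>i \<in> {..<k}. f i) \<oplus> f k"
  using assms by (simp add: lessThan_Suc a_comm finsum_closed Pi_def)

lemma Span_sequence:
  assumes K: "subfield K R" and V: "\<And>i. V i \<in> carrier R"
    and "a \<in> Span K (map V (rev [0..<m]))"
  shows "\<exists>c. (\<forall>i. c i \<in> K) \<and> a = (\<Oplus>i \<in> {..<m}. c i \<otimes> V i)"
  using assms(3)
proof (induction m arbitrary: a)
  case 0
  then show ?case using subringE(2)[OF subfieldE(1)[OF K]] by (intro exI[of _ "\<lambda>_. \<zero>"]) simp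
next
  case (Suc m)
  then obtain k v where kv: "k \<in> K" "v \<in> Span K (map V (rev [0..<m]))" "a = k \<otimes> V m \<oplus> v"
    by (auto simp: line_extension_mem_iff)
  from Suc.IH[OF kv(2)] obtain c where c: "\<forall>i. c i \<in> K" "v = (\<Oplus>i \<in> {..<m}. c i \<otimes> V i)" by blast
  define d where "d = c(m := k)"
  have d: "d i \<in> K" for i unfolding d_def using c(1) kv(1) by simp
  then have car: "d i \<otimes> V i \<in> carrier R" for i using V subfieldE(3)[OF K] by blast
  have "v = (\<Oplus>i \<in> {..<m}. d i \<otimes> V i)"
    unfolding c(2) using car by (intro finsum_cong') (auto simp: d_def)
  moreover have "v \<in> carrier R" unfolding calculation using car by (intro finsum_closed) auto
  ultimately have "a = (\<Oplus>i \<in> {..<Suc m}. d i \<otimes> V i)"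
    using finsum_lessThan_Suc[of "\<lambda>i. d i \<otimes> V i" m] car car[of m] kv(3)
    by (simp add: d_def a_comm)
  then show ?case using d by blast
qed

text \<open>
  Otherwise every initial segment of the sequence would be linearly independent.
\<close>

lemma sequence_linear_relation:
  fixes V :: "nat \<Rightarrow> 'a"
  assumes K: "subfield K R" and fin: "finite_dimension K E"
    and V: "\<And>i. V i \<in> E" "\<And>i. V i \<in> carrier R"
  shows "\<exists>m c. (\<forall>i. c i \<in> K) \<and> V m = (\<Oplus>i \<in> {..<m}. c i \<otimes> V i)"
proof -
  from fin obtain n where n: "dimension n K E" by auto
  have "\<exists>m. V m \<in> Span K (map V (rev [0..<m]))"
  proof (rule ccontr)
    assume "\<not> ?thesis"
    then have none: "V m \<notin> Span K (map V (rev [0..<m]))" for m by blast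
    have "independent K (map V (rev [0..<m]))" for m
    proof (induction m)
      case (Suc m)
      then show ?case using li_Cons[OF V(2) none Suc] by simp
    qed simp
    from independent_length_le_dimension[OF K n this[of "Suc n"]] show False using V(1) by auto
  qed
  then obtain m where "V m \<in> Span K (map V (rev [0..<m]))" by blast
  from Span_sequence[of K V "V m" m, OF K V(2) this] show ?thesis by blast
qed

end

context domain_positive_characteristic
begin

abbreviation "p \<equiv> characteristic R"

lemma frobenius_uminus_one: "(\<ominus> \<one>) [^] p = \<ominus> \<one>"
proof -
  interpret F: additive_endomorphism R "\<lambda>x. x [^] p" by (rule additive_endomorphism_frobenius)
  show ?thesis using F.f_diff[of \<zero> \<one>] F.f_zero by (simp add: a_minus_def)
qed

text \<open>
  Look for \<open>w\<close> of the form \<open>(\<Sum>i<m. y (i + 1) * v\<^bsup>p^i\<^esup>)\<close>. Applying the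
  Frobenius map shifts the powers of \<open>v\<close>, and the highest one is eliminated with the given
  relation. Comparing coefficients of \<open>w\<^sup>p - w = v\<close> leads to the recursion for
  \<open>y\<close>, in which the last coefficient \<open>y m\<close> occurs on the right-hand side.
  The value \<open>y 0 = -1\<close> accounts for \<open>v\<close> itself.
\<close>

lemma artin_schreier_solution:
  assumes v: "v \<in> carrier R" and d: "\<And>i. d i \<in> carrier R" and y: "\<And>i. y i \<in> carrier R"
    and rel: "v [^] (p ^ m) = (\<Oplus>i \<in> {..<m}. d i \<otimes> v [^] (p ^ i))"
    and y0: "y 0 = \<ominus> \<one>" and ySuc: "\<And>i. y (Suc i) = y i [^] p \<oplus> d i \<otimes> y m [^] p"
  shows "\<exists>w \<in> carrier R. w [^] p \<ominus> w = v"
proof -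
  define V where "V i = v [^] (p ^ i)" for i
  have V: "V i \<in> carrier R" for i unfolding V_def using v by simp
  have VSuc: "V (Suc i) = V i [^] p" for i
    unfolding V_def using v by (simp add: nat_pow_pow mult.commute)
  define P where "P k = (\<Oplus>i \<in> {..<k}. d i \<otimes> V i)" for k
  define W where "W k = (\<Oplus>i \<in> {..<k}. y (Suc i) \<otimes> V i)" for k
  have car: "P k \<in> carrier R" "W k \<in> carrier R" for k
    unfolding P_def W_def using d y V by (auto intro!: finsum_closed)
  have PSuc: "P (Suc k) = P k \<oplus> d k \<otimes> V k" and WSuc: "W (Suc k) = W k \<oplus> y (Suc k) \<otimes> V k" for k
    unfolding P_def W_def using d y V by (auto intro!: finsum_lessThan_Suc)
  define s where "s = y m [^] p"
  have s: "s \<in> carrier R" unfolding s_def using y by simp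
  (* P and W are the partial sums of the relation and of the solution; at k = m the relation
     turns P m into V m and the two terms with s cancel. *)
  have "W k [^] p \<oplus> s \<otimes> P k \<ominus> W k = v \<oplus> y k [^] p \<otimes> V k" for k
  proof (induction k)
    case 0
    have "V 0 = v" unfolding V_def using v by simp
    moreover have "\<zero> [^] p = \<zero>" using characteristic_pos by (simp add: nat_pow_zero)
    moreover have "\<zero> \<oplus> s \<otimes> \<zero> \<ominus> \<zero> = v \<oplus> \<ominus> \<one> \<otimes> v" using v s by algebra
    ultimately show ?case using y0 by (simp add: P_def W_def frobenius_uminus_one)
  next
    case (Suc k)
    have "W (Suc k) [^] p = W k [^] p \<oplus> y (Suc k) [^] p \<otimes> V (Suc k)"
      unfolding WSuc VSuc using car y V by (simp add: frobenius_add nat_pow_distrib)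
    then have "W (Suc k) [^] p \<oplus> s \<otimes> P (Suc k) \<ominus> W (Suc k)
        = (W k [^] p \<oplus> y (Suc k) [^] p \<otimes> V (Suc k)) \<oplus> s \<otimes> (P k \<oplus> d k \<otimes> V k)
          \<ominus> (W k \<oplus> y (Suc k) \<otimes> V k)"
      unfolding PSuc WSuc by simp
    also have "\<dots> = (W k [^] p \<oplus> s \<otimes> P k \<ominus> W k) \<oplus> y (Suc k) [^] p \<otimes> V (Suc k)
          \<oplus> (s \<otimes> d k \<ominus> y (Suc k)) \<otimes> V k"
    proof -
      have "W k [^] p \<in> carrier R" "y (Suc k) [^] p \<in> carrier R" using car y by auto
      then show ?thesis using car[of k] s d[of k] y[of "Suc k"] V[of k] V[of "Suc k"] by algebra
    qed
    also have "\<dots> = v \<oplus> y (Suc k) [^] p \<otimes> V (Suc k)"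
    proof -
      have c: "y k [^] p \<in> carrier R" "y (Suc k) [^] p \<in> carrier R" using y by auto
      show ?thesis
        unfolding Suc ySuc[of k] s_def[symmetric]
      proof -
        have "(y k [^] p \<oplus> d k \<otimes> s) [^] p \<in> carrier R" using c s d by simp
        then show "v \<oplus> y k [^] p \<otimes> V k \<oplus> (y k [^] p \<oplus> d k \<otimes> s) [^] p \<otimes> V (Suc k)
            \<oplus> (s \<otimes> d k \<ominus> (y k [^] p \<oplus> d k \<otimes> s)) \<otimes> V k
          = v \<oplus> (y k [^] p \<oplus> d k \<otimes> s) [^] p \<otimes> V (Suc k)"
          using v c s d[of k] V[of k] V[of "Suc k"] by algebra
      qed
    qed
    finally show ?case .
  qed
  from this[of m] have "W m [^] p \<oplus> s \<otimes> V m \<ominus> W m = v \<oplus> s \<otimes> V m"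
    using rel unfolding s_def P_def V_def by simp
  then have "W m [^] p \<ominus> W m = (v \<oplus> s \<otimes> V m) \<ominus> s \<otimes> V m"
  proof -
    assume eq: "W m [^] p \<oplus> s \<otimes> V m \<ominus> W m = v \<oplus> s \<otimes> V m"
    have "W m [^] p \<in> carrier R" using car by simp
    then have "W m [^] p \<ominus> W m = (W m [^] p \<oplus> s \<otimes> V m \<ominus> W m) \<ominus> s \<otimes> V m"
      using car(2)[of m] s V[of m] by algebra
    then show ?thesis unfolding eq .
  qed
  also have "\<dots> = v" using v s V[of m] by algebra
  finally show ?thesis using car(2) by blast
qed

text \<open>
  The recursion of \<open>artin_schreier_solution\<close>, read as a function of the unknown last
  coefficient \<open>z\<close> and started at 0 instead of \<open>-1\<close>. This makes it additive in \<open>z\<close>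
  and changes every term by 1, so the recursion closes up when
  \<open>additive_iterate c m z - z = 1\<close>.
\<close>

fun additive_iterate :: "(nat \<Rightarrow> 'a) \<Rightarrow> nat \<Rightarrow> 'a \<Rightarrow> 'a" where
  "additive_iterate c 0 z = \<zero>"
| "additive_iterate c (Suc k) z = additive_iterate c k z [^] p \<oplus> c k \<otimes> z [^] p"

lemma additive_endomorphism_iterate:
  assumes c: "\<And>i. c i \<in> carrier R" shows "additive_endomorphism R (additive_iterate c k)"
proof (induction k)
  case 0
  show ?case by unfold_locales simp_all
next
  case (Suc k)
  interpret G: additive_endomorphism R "additive_iterate c k" by (rule Suc)
  show ?case
  proof
    show "additive_iterate c (Suc k) x \<in> carrier R" if "x \<in> carrier R" for x
      using that c G.f_closed by simp
    fix x y assume xy: "x \<in> carrier R" "y \<in> carrier R"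
    define a b where "a = additive_iterate c k x [^] p" and "b = additive_iterate c k y [^] p"
    have car: "a \<in> carrier R" "b \<in> carrier R" "x [^] p \<in> carrier R" "y [^] p \<in> carrier R"
      unfolding a_def b_def using xy G.f_closed by auto
    have "(a \<oplus> b) \<oplus> c k \<otimes> (x [^] p \<oplus> y [^] p) = (a \<oplus> c k \<otimes> x [^] p) \<oplus> (b \<oplus> c k \<otimes> y [^] p)"
      using car c[of k] by algebra
    then show "additive_iterate c (Suc k) (x \<oplus> y)
        = additive_iterate c (Suc k) x \<oplus> additive_iterate c (Suc k) y"
      unfolding a_def b_def using xy G.f_closed by (simp add: G.f_add frobenius_add)
  qed
qed

lemma additive_iterate_divisible:
  assumes c: "\<And>i. c i \<in> carrier R"
  shows "\<exists>q. polynomial_function q \<and> (\<forall>z \<in> carrier R. additive_iterate c k z = z \<otimes> (z \<otimes> q z))"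
proof (induction k)
  case 0
  show ?case by (intro exI[of _ "\<lambda>_. \<zero>"]) (simp add: polynomial_function_const)
next
  case (Suc k)
  then obtain q where q: "polynomial_function q"
      "\<forall>z \<in> carrier R. additive_iterate c k z = z \<otimes> (z \<otimes> q z)" by blast
  define r where "r = p - 2"
  have r: "p = Suc (Suc r)" using prime_ge_2_nat[OF prime_characteristic] unfolding r_def by simp
  define q' where "q' z = (z \<otimes> (z \<otimes> q z)) [^] r \<otimes> (q z \<otimes> (z \<otimes> (z \<otimes> q z))) \<oplus> c k \<otimes> z [^] r" for z
  have "polynomial_function q'"
    unfolding q'_def
    by (intro polynomial_function_add polynomial_function_mult polynomial_function_pow
        polynomial_function_id polynomial_function_const c q(1))
  moreover have "additive_iterate c (Suc k) z = z \<otimes> (z \<otimes> q' z)" if z: "z \<in> carrier R" for z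
  proof -
    define u where "u = z \<otimes> (z \<otimes> q z)"
    have car: "q z \<in> carrier R" "u [^] r \<in> carrier R" "z [^] r \<in> carrier R" "u \<in> carrier R"
      unfolding u_def using polynomial_function_closed[OF q(1) z] z by auto
    have "additive_iterate c (Suc k) z = u [^] r \<otimes> u \<otimes> u \<oplus> c k \<otimes> (z [^] r \<otimes> z \<otimes> z)"
      using q(2) z unfolding additive_iterate.simps r u_def by simp
    also have "u [^] r \<otimes> u \<otimes> u = u [^] r \<otimes> (z \<otimes> (z \<otimes> q z)) \<otimes> u" by (simp add: u_def)
    also have "u [^] r \<otimes> (z \<otimes> (z \<otimes> q z)) \<otimes> u \<oplus> c k \<otimes> (z [^] r \<otimes> z \<otimes> z)
        = z \<otimes> (z \<otimes> (u [^] r \<otimes> (q z \<otimes> u) \<oplus> c k \<otimes> z [^] r))"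
      using car z c[of k] by algebra
    finally show ?thesis unfolding q'_def u_def .
  qed
  ultimately show ?case by blast
qed

text \<open>
  A zero other than 0 satisfies \<open>z q(z) - 1 = 0\<close>, and the left-hand side is \<open>-1\<close> at
  \<open>z = 0\<close>. Divisibility of the iterate by \<open>z\<^sup>2\<close> is what makes the linear term
  \<open>- z\<close> survive.
\<close>

lemma finite_kernel_iterate_minus_id:
  assumes c: "\<And>i. c i \<in> carrier R"
  shows "finite {z \<in> carrier R. additive_iterate c k z \<ominus> z = \<zero>}"
proof -
  from additive_iterate_divisible[of c k] c obtain q where q: "polynomial_function q"
      "\<forall>z \<in> carrier R. additive_iterate c k z = z \<otimes> (z \<otimes> q z)" by blast
  have pf: "polynomial_function (\<lambda>z. z \<otimes> q z \<oplus> \<ominus> \<one>)"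
    by (intro polynomial_function_add polynomial_function_mult polynomial_function_id
        polynomial_function_const q(1)) simp
  have "\<zero> \<otimes> q \<zero> \<oplus> \<ominus> \<one> \<noteq> \<zero>" using polynomial_function_closed[OF q(1)] by simp
  from polynomial_function_finite_zeros[OF pf _ this]
  have fin: "finite {z \<in> carrier R. z \<otimes> q z \<oplus> \<ominus> \<one> = \<zero>}" by simp
  have "{z \<in> carrier R. additive_iterate c k z \<ominus> z = \<zero>}
      \<subseteq> insert \<zero> {z \<in> carrier R. z \<otimes> q z \<oplus> \<ominus> \<one> = \<zero>}"
  proof
    fix z assume "z \<in> {z \<in> carrier R. additive_iterate c k z \<ominus> z = \<zero>}"
    then have z: "z \<in> carrier R" "z \<otimes> (z \<otimes> q z) \<ominus> z = \<zero>" using q(2) by auto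
    have qz: "q z \<in> carrier R" using polynomial_function_closed[OF q(1) z(1)] .
    have "z \<otimes> (z \<otimes> q z \<oplus> \<ominus> \<one>) = z \<otimes> (z \<otimes> q z) \<ominus> z" using z(1) qz by algebra
    then have "z \<otimes> (z \<otimes> q z \<oplus> \<ominus> \<one>) = \<zero>" using z(2) by simp
    then show "z \<in> insert \<zero> {z \<in> carrier R. z \<otimes> q z \<oplus> \<ominus> \<one> = \<zero>}"
      using z(1) qz by (auto simp: integral_iff)
  qed
  then show ?thesis using fin finite_subset by blast
qed

end

lemma (in field_expansion) Term_additive_iterate:
  assumes "domain_positive_characteristic K" "A \<subseteq> carrier K" "\<And>i. i < k \<Longrightarrow> c i \<in> A"
  shows "Term A {n} (\<lambda>e. domain_positive_characteristic.additive_iterate K c k (e n))"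
proof -
  interpret P: domain_positive_characteristic K by (rule assms(1))
  show ?thesis using assms(3)
  proof (induction k)
    case 0
    show ?case by (simp add: Term_zero)
  next
    case (Suc k)
    then have "Term A {n} (\<lambda>e. P.additive_iterate c k (e n))" by simp
    then have "Term A {n} (\<lambda>e. P.additive_iterate c k (e n) [^] characteristic K
        \<oplus> c k \<otimes> e n [^] characteristic K)"
      using Suc.prems[of k]
      by (intro Term_add Term_mult Term_pow assms(2) term_map_par term_map_var) auto
    then show ?case by simp
  qed
qed

text \<open>
  The powers \<open>v\<^bsup>p^i\<^esup>\<close> lie in the finite-dimensional extension generated by
  \<open>v\<close>, so they satisfy a linear relation over \<open>K\<close>. This reduces the equation for
  \<open>v\<close> over \<open>L\<close> to a single additive equation over \<open>K\<close>, to which weak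
  smallness applies.
\<close>

theorem (in field_expansion) artin_schreier_solvable_over_algebraic_extension:
  fixes L :: "'b ring" and h :: "'a \<Rightarrow> 'b"
  assumes ws: "weakly_small \<L> M" and inf: "infinite (carrier K)"
    and L: "field L" and h: "h \<in> ring_hom K L" and pos: "characteristic L > 0"
    and v: "v \<in> carrier L" and alg: "((ring.algebraic L) over (h ` carrier K)) v"
  shows "\<exists>w \<in> carrier L. w [^]\<^bsub>L\<^esub> characteristic L \<ominus>\<^bsub>L\<^esub> w = v"
proof -
  define p where "p = characteristic L"
  have pK: "characteristic K = p" unfolding p_def using characteristic_hom[OF field_axioms L h] by simp
  interpret L: field L by (rule L)
  interpret L: domain_positive_characteristic L by unfold_locales (rule pos)
  interpret P: domain_positive_characteristic K by unfold_locales (use pos pK p_def in simp)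
  interpret h: ring_hom_ring K L h
    using h by (intro ring_hom_ringI2 ring_axioms L.ring_axioms)
  define k where "k = h ` carrier K"
  have k: "subfield k L"
    unfolding k_def by (intro h.img_is_subfield(2) carrier_is_subfield) simp
  define E where "E = L.simple_extension k v"
  have fin: "L.finite_dimension k E"
    unfolding E_def using L.finite_dimension_simple_extension[OF k v] alg k_def by simp
  have E: "subring E L" unfolding E_def by (rule L.simple_extension_is_subring[OF subfieldE(1)[OF k] v])
  have vE: "v \<in> E" unfolding E_def by (rule L.simple_extension_mem[OF subfieldE(1)[OF k] v])
  have "v [^]\<^bsub>L\<^esub> (n::nat) \<in> E" for n
    by (induction n) (simp_all add: subringE(3)[OF E] subringE(6)[OF E] vE)
  from L.sequence_linear_relation[OF k fin, of "\<lambda>i. v [^]\<^bsub>L\<^esub> (p ^ i)"] this v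
  obtain m c' where c': "\<And>i. c' i \<in> k"
      "v [^]\<^bsub>L\<^esub> (p ^ m) = (\<Oplus>\<^bsub>L\<^esub>i \<in> {..<m}. c' i \<otimes>\<^bsub>L\<^esub> v [^]\<^bsub>L\<^esub> (p ^ i))"
    by auto
  define c where "c i = inv_into (carrier K) h (c' i)" for i
  have c: "c i \<in> carrier K" "h (c i) = c' i" for i
    unfolding c_def using inv_into_into[of "c' i"] f_inv_into_f[of "c' i"] c'(1)[of i] k_def by simp_all
  define G where "G = P.additive_iterate c"
  have G0: "G 0 z = \<zero>" and GSuc: "G (Suc i) z = G i z [^] p \<oplus> c i \<otimes> z [^] p" for i z
    unfolding G_def by (simp_all add: pK)
  have G: "additive_endomorphism K (G i)" for i
    unfolding G_def by (rule P.additive_endomorphism_iterate[OF c(1)])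
  define f where "f z = G m z \<ominus> z" for z
  have f: "additive_endomorphism K f"
  proof -
    interpret G: additive_endomorphism K "G m" by (rule G)
    have "(G m x \<oplus> G m y) \<ominus> (x \<oplus> y) = (G m x \<ominus> x) \<oplus> (G m y \<ominus> y)"
      if "x \<in> carrier K" "y \<in> carrier K" for x y
      using that G.f_closed[OF that(1)] G.f_closed[OF that(2)] by algebra
    then show ?thesis unfolding f_def by unfold_locales (simp_all add: G.f_closed G.f_add)
  qed
  define A where "A = c ` {..<m}"
  have A: "finite A" "A \<subseteq> carrier K" unfolding A_def using c(1) by auto
  have "Term A {n} (\<lambda>e. G m (e n))" for n
    unfolding G_def
    by (rule Term_additive_iterate[OF P.domain_positive_characteristic_axioms A(2)])
      (simp add: A_def)
  then have Term_f: "Term A {n} (\<lambda>e. f (e n))" for n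
    unfolding f_def a_minus_def by (intro Term_add Term_minus A(2) term_map_var) auto
  have "finite {z \<in> carrier K. f z = \<zero>}"
    unfolding f_def G_def by (rule P.finite_kernel_iterate_minus_id[OF c(1)])
  from additive_endomorphism_surjective[OF ws inf A f Term_f this]
  obtain z where z: "z \<in> carrier K" "f z = \<one>" by (metis imageE one_closed)
  have Gc: "G i z \<in> carrier K" for i using additive_endomorphism.f_closed[OF G z(1)] .
  have Gm: "G m z \<ominus> \<one> = z"
  proof -
    have "G m z \<ominus> f z = z" unfolding f_def using Gc[of m] z(1) by algebra
    then show ?thesis using z(2) by simp
  qed
  define y where "y i = h (G i z \<ominus> \<one>)" for i
  have "y (Suc i) = y i [^]\<^bsub>L\<^esub> p \<oplus>\<^bsub>L\<^esub> h (c i) \<otimes>\<^bsub>L\<^esub> y m [^]\<^bsub>L\<^esub> p" for i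
  proof -
    interpret F: additive_endomorphism K "\<lambda>x. x [^] p"
      using P.additive_endomorphism_frobenius unfolding pK .
    have "(G i z \<ominus> \<one>) [^] p = G i z [^] p \<ominus> \<one>" using F.f_diff[OF Gc one_closed] by simp
    moreover have "G (Suc i) z \<ominus> \<one> = (G i z [^] p \<ominus> \<one>) \<oplus> c i \<otimes> z [^] p"
    proof -
      have "G i z [^] p \<in> carrier K" "z [^] p \<in> carrier K" using Gc z(1) by auto
      then show ?thesis unfolding GSuc using c(1)[of i] by algebra
    qed
    ultimately have "G (Suc i) z \<ominus> \<one> = (G i z \<ominus> \<one>) [^] p \<oplus> c i \<otimes> (G m z \<ominus> \<one>) [^] p"
      using Gm by simp
    then show ?thesis unfolding y_def using Gc c(1) by (simp add: h.hom_nat_pow)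
  qed
  moreover have "y 0 = \<ominus>\<^bsub>L\<^esub> \<one>\<^bsub>L\<^esub>" unfolding y_def G0 by (simp add: a_minus_def)
  moreover have "y i \<in> carrier L" for i unfolding y_def using Gc by simp
  moreover have "h (c i) \<in> carrier L" for i using c(1) by simp
  moreover have "v [^]\<^bsub>L\<^esub> (p ^ m) = (\<Oplus>\<^bsub>L\<^esub>i \<in> {..<m}. h (c i) \<otimes>\<^bsub>L\<^esub> v [^]\<^bsub>L\<^esub> (p ^ i))"
    using c'(2) c(2) by simp
  ultimately show ?thesis
    using L.artin_schreier_solution[OF v, of "\<lambda>i. h (c i)" y m] unfolding p_def by blast
qed

section \<open>Artin-Schreier extensions of closed fields\<close>

text \<open>
  The multiples of 1 already are as many roots of \<open>X\<^sup>p - X\<close> as its degree permits.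
\<close>

lemma fixed_points_of_frobenius:
  fixes L :: "'b ring" (structure)
  assumes L: "field L" and pos: "characteristic L > 0"
    and t: "t \<in> carrier L" "t [^] characteristic L = t"
  shows "\<exists>n::nat. t = add_pow L n \<one>"
proof (rule ccontr)
  assume none: "\<not> ?thesis"
  interpret field L by (rule L)
  interpret domain_positive_characteristic L by unfold_locales (rule pos)
  define q where "q = characteristic L"
  have q2: "2 \<le> q" unfolding q_def using prime_ge_2_nat[OF prime_characteristic] .
  define r where "r = q - 2"
  have r: "q = Suc (Suc r)" unfolding r_def using q2 by simp
  define P where "P = \<one> # replicate r \<zero> @ [\<ominus> \<one>, \<zero>]"
  have P: "P \<in> carrier (poly_ring L)"
    unfolding P_def univ_poly_carrier[symmetric] polynomial_def by auto
  have deg: "length P - 1 = q" unfolding P_def r by simp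
  have "is_root P a" if "a \<in> carrier L" "a [^] q = a" for a
  proof -
    have "eval P a = a [^] q \<oplus> eval [\<ominus> \<one>, \<zero>] a"
      unfolding P_def using that(1) eval_replicate[of "[\<ominus> \<one>, \<zero>]" a r] by (simp add: r)
    also have "\<dots> = a \<oplus> \<ominus> \<one> \<otimes> a" using that by simp
    also have "\<dots> = \<zero>" using that(1) by algebra
    finally show ?thesis unfolding is_root_def using that(1) by (simp add: P_def)
  qed
  then have root: "a \<in># roots P" if "a \<in> carrier L" "a [^] q = a" for a
    using that roots_mem_iff_is_root[OF P] by blast
  define N where "N = (\<lambda>n::nat. add_pow L n \<one>) ` {..<q}"
  have inj: "inj_on (\<lambda>n::nat. add_pow L n \<one>) {..<q}"
  proof (rule linorder_inj_onI)
    fix i j assume ij: "i < j" "i \<in> {..<q}" "j \<in> {..<q}"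
    show "add_pow L i \<one> \<noteq> add_pow L j \<one>"
    proof
      assume eq: "add_pow L i \<one> = add_pow L j \<one>"
      have "add_pow L i \<one> \<oplus> add_pow L (j - i) \<one> = add_pow L i \<one> \<oplus> \<zero>"
        using eq ij(1) add.nat_pow_mult[of \<one> i "j - i"] by simp
      then have "add_pow L (j - i) \<one> = \<zero>" by simp
      then have "q \<le> j - i" unfolding q_def using ij(1) by (intro characteristic_least) auto
      then show False using ij by auto
    qed
  qed auto
  have "add_pow L n \<one> [^] q = add_pow L n \<one>" for n :: nat
  proof (induction n)
    case 0
    show ?case using q2 by (simp add: nat_pow_zero)
  next
    case (Suc n)
    then show ?case using frobenius_add[of "add_pow L n \<one>" \<one>] unfolding q_def by simp
  qed
  then have "insert t N \<subseteq> set_mset (roots P)"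
    unfolding N_def using root t q_def by auto
  then have "card (insert t N) \<le> card (set_mset (roots P))" by (intro card_mono) auto
  also have "\<dots> \<le> size (roots P)" using size_mset_mono[OF mset_set_set_mset_msubset[of "roots P"]] by simp
  also have "\<dots> \<le> q" using size_roots_le_degree[OF P] deg by simp
  finally have "card (insert t N) \<le> q" .
  moreover have "card N = q" unfolding N_def using card_image[OF inj] by simp
  moreover have "t \<notin> N" using none unfolding N_def by blast
  moreover have "finite N" unfolding N_def by simp
  ultimately show False by simp
qed

text \<open>
  A generator \<open>x\<close> differs from the image of a solution in \<open>L\<close> of the same equation by a
  fixed point of the Frobenius map, and those lie in the prime field.
\<close>

lemma artin_schreier_extension_of_closed:
  fixes L :: "'b ring" and L' :: "'c ring"
  assumes closed: "artin_schreier_closed L" and ext: "artin_schreier_extension L L' j"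
  shows "j ` carrier L = carrier L'"
proof -
  from ext obtain x where L: "field L" "field L'" "j \<in> ring_hom L L'" and pos: "characteristic L > 0"
      and x: "x \<in> carrier L'" "artin_schreier_map L' x \<in> j ` carrier L"
      "carrier L' = generate_field L' (insert x (j ` carrier L))"
    unfolding artin_schreier_extension_def field_extension_def by blast
  interpret L: field L by (rule L)
  interpret L': field L' by (rule L)
  interpret j: ring_hom_ring L L' j
    using L(3) by (intro ring_hom_ringI2 L.ring_axioms L'.ring_axioms)
  define p where "p = characteristic L'"
  have pL: "characteristic L = p" unfolding p_def using characteristic_hom[OF L] by simp
  interpret L': domain_positive_characteristic L' by unfold_locales (use pos pL p_def in simp)
  interpret F: additive_endomorphism L' "\<lambda>x. x [^]\<^bsub>L'\<^esub> p"
    using L'.additive_endomorphism_frobenius unfolding p_def .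
  obtain a where a: "a \<in> carrier L" "artin_schreier_map L' x = j a" using x(2) by blast
  have "a \<in> artin_schreier_map L ` carrier L"
    using closed pos a(1) unfolding artin_schreier_closed_def by simp
  then obtain y where y: "y \<in> carrier L" "artin_schreier_map L y = a" by (auto elim!: imageE)
  define t where "t = x \<ominus>\<^bsub>L'\<^esub> j y"
  have t: "t \<in> carrier L'" unfolding t_def using x(1) y(1) by simp
  have jy: "j y \<in> carrier L'" "j y [^]\<^bsub>L'\<^esub> p \<in> carrier L'" "x [^]\<^bsub>L'\<^esub> p \<in> carrier L'"
    using y(1) x(1) by auto
  have eq: "x [^]\<^bsub>L'\<^esub> p \<ominus>\<^bsub>L'\<^esub> x = j y [^]\<^bsub>L'\<^esub> p \<ominus>\<^bsub>L'\<^esub> j y"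
  proof -
    have "j a = j (y [^]\<^bsub>L\<^esub> p \<ominus>\<^bsub>L\<^esub> y)" using y(2) unfolding artin_schreier_map_def pL by simp
    also have "\<dots> = j y [^]\<^bsub>L'\<^esub> p \<ominus>\<^bsub>L'\<^esub> j y" using y(1) by (simp add: a_minus_def j.hom_nat_pow)
    finally show ?thesis using a(2) unfolding artin_schreier_map_def p_def by simp
  qed
  have "t [^]\<^bsub>L'\<^esub> p \<ominus>\<^bsub>L'\<^esub> t = (x [^]\<^bsub>L'\<^esub> p \<ominus>\<^bsub>L'\<^esub> x) \<ominus>\<^bsub>L'\<^esub> (j y [^]\<^bsub>L'\<^esub> p \<ominus>\<^bsub>L'\<^esub> j y)"
    unfolding t_def F.f_diff[OF x(1) jy(1)] using x(1) jy by algebra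
  also have "\<dots> = \<zero>\<^bsub>L'\<^esub>" unfolding eq using jy by algebra
  finally have "t [^]\<^bsub>L'\<^esub> p = t" using t by simp
  then obtain n :: nat where n: "t = add_pow L' n \<one>\<^bsub>L'\<^esub>"
    using fixed_points_of_frobenius[OF L(2) L'.characteristic_pos t] unfolding p_def by blast
  have "j (add_pow L n \<one>\<^bsub>L\<^esub>) = add_pow L' n \<one>\<^bsub>L'\<^esub>" for n :: nat
    by (induction n) simp_all
  then have "j (y \<oplus>\<^bsub>L\<^esub> add_pow L n \<one>\<^bsub>L\<^esub>) = j y \<oplus>\<^bsub>L'\<^esub> t" using y(1) n by simp
  also have "\<dots> = x" unfolding t_def using x(1) jy(1) by algebra
  finally have "x \<in> j ` carrier L" using y(1) by (intro image_eqI[of _ _ "y \<oplus>\<^bsub>L\<^esub> add_pow L n \<one>\<^bsub>L\<^esub>"]) simp_all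
  moreover have "subfield (j ` carrier L) L'"
    by (intro j.img_is_subfield(2) L.carrier_is_subfield) simp
  moreover have "j ` carrier L \<subseteq> carrier L'" by auto
  ultimately show ?thesis
    using L'.generate_field_min_subfield1[of "insert x (j ` carrier L)" "j ` carrier L"] x(1,3) by auto
qed

theorem corollary2p18:
  fixes K :: "'a ring" and L :: "'b ring" and h :: "'a \<Rightarrow> 'b"
    and \<L> :: "('f field_sym, 'r) language" and M :: "('f field_sym, 'r, 'a) fo_struct"
  assumes "field K" and "infinite (carrier K)"
    and "expands_field \<L> M K" and "weakly_small \<L> M"
    and "algebraic_field_extension K L h"
  shows "artin_schreier_closed L \<and>
    (\<forall>(L' :: 'c ring) j. artin_schreier_extension L L' j \<longrightarrow> j ` carrier L = carrier L')"
proof -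
  interpret field_expansion K \<L> M
    using assms(1,3) by (intro field_expansion.intro field_expansion_axioms.intro)
  from assms(5) have L: "field L" and h: "h \<in> ring_hom K L"
    and alg: "\<And>x. x \<in> carrier L \<Longrightarrow> ((ring.algebraic L) over (h ` carrier K)) x"
    unfolding algebraic_field_extension_def field_extension_def by auto
  interpret L: field L by (rule L)
  have "artin_schreier_map L ` carrier L = carrier L" if pos: "characteristic L > 0"
  proof
    show "artin_schreier_map L ` carrier L \<subseteq> carrier L" unfolding artin_schreier_map_def by auto
    show "carrier L \<subseteq> artin_schreier_map L ` carrier L"
    proof
      fix v assume v: "v \<in> carrier L"
      from artin_schreier_solvable_over_algebraic_extension[OF assms(4,2) L h pos v alg[OF v]]
      show "v \<in> artin_schreier_map L ` carrier L" unfolding artin_schreier_map_def by blast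
    qed
  qed
  then have "artin_schreier_closed L" unfolding artin_schreier_closed_def by blast
  then show ?thesis using artin_schreier_extension_of_closed by blast
qed

end
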